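(* Let $(B_t\colon t\ge0)$ be a standard planar Brownian motion. For every gauge function $\phi$ with $\phi(\varepsilon)\log(1/\varepsilon)\to0$ as $\varepsilon\downarrow0$, almost surely, $$\mathcal{H}^\phi\big(\{t\ge0\colon B_t=x\}\big)=0\qquad\text{for every }x\in\mathbb{R}^2.$$
   Context: A gauge function is a right-continuous, increasing function $\phi\colon(0,\varepsilon_0)\to[0,1]$ (for some $\varepsilon_0>0$) with $\phi(0+)=0$. For $E\subset\mathbb{R}$, the $\phi$-Hausdorff measure is $$\mathcal{H}^\phi(E)=\lim_{\delta\downarrow 0}\inf\Big\{\sum_{i=1}^\infty\phi(\mathrm{diam}(E_i))\colon E\subseteq\bigcup_{i=1}^\infty E_i,\ 0<\mathrm{diam}(E_i)<\delta\Big\}.$$ *)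

theory Defs
  imports "HOL-Probability.Probability"
begin

(* Gauges are total functions on the reals; only their values on some interval
   (0, e) matter. *)
definition gauge_function :: "(real \<Rightarrow> real) \<Rightarrow> bool" where
  "gauge_function \<phi> \<longleftrightarrow>
     (\<exists>\<epsilon>\<^sub>0>0. \<phi> ` {0<..<\<epsilon>\<^sub>0} \<subseteq> {0..1} \<and>
             (\<forall>r\<in>{0<..<\<epsilon>\<^sub>0}. continuous (at_right r) \<phi>) \<and>
             mono_on {0<..<\<epsilon>\<^sub>0} \<phi>) \<and>
     (\<phi> \<longlongrightarrow> 0) (at_right 0)"

(* Boundedness must be required separately: diameter is real-valued and carries
   no information on unbounded sets, whose mathematical diameter is infinite. *)
definition hausdorff_covers :: "real \<Rightarrow> real set \<Rightarrow> (nat \<Rightarrow> real set) set" where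
  "hausdorff_covers \<delta> A =
     {E. A \<subseteq> (\<Union>i. E i) \<and>
         (\<forall>i. bounded (E i) \<and> 0 < diameter (E i) \<and> diameter (E i) < \<delta>)}"

definition hausdorff_content :: "(real \<Rightarrow> real) \<Rightarrow> real \<Rightarrow> real set \<Rightarrow> ennreal" where
  "hausdorff_content \<phi> \<delta> A =
     (INF E\<in>hausdorff_covers \<delta> A. \<Sum>i. ennreal (\<phi> (diameter (E i))))"

definition hausdorff_measure :: "(real \<Rightarrow> real) \<Rightarrow> real set \<Rightarrow> ennreal" where
  "hausdorff_measure \<phi> A = Lim (at_right 0) (\<lambda>\<delta>. hausdorff_content \<phi> \<delta> A)"

lemma hausdorff_content_antimono:
  assumes "\<delta> \<le> \<delta>'"
  shows "hausdorff_content \<phi> \<delta>' A \<le> hausdorff_content \<phi> \<delta> A"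
proof -
  have "hausdorff_covers \<delta> A \<subseteq> hausdorff_covers \<delta>' A"
    using assms unfolding hausdorff_covers_def by (auto intro: less_le_trans)
  then show ?thesis
    unfolding hausdorff_content_def by (rule INF_superset_mono) simp
qed

lemma hausdorff_content_tendsto_SUP:
  "((\<lambda>\<delta>. hausdorff_content \<phi> \<delta> A) \<longlongrightarrow> (SUP \<delta>\<in>{0<..}. hausdorff_content \<phi> \<delta> A)) (at_right 0)"
proof (rule order_tendstoI)
  fix a assume "a < (SUP \<delta>\<in>{0<..}. hausdorff_content \<phi> \<delta> A)"
  then obtain d where d: "d > 0" "a < hausdorff_content \<phi> d A"
    by (auto simp: less_SUP_iff)
  have "\<forall>\<^sub>F \<delta> in at_right (0::real). \<delta> < d"
    using d(1) by (auto simp: eventually_at_right_field)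
  then show "\<forall>\<^sub>F \<delta> in at_right 0. a < hausdorff_content \<phi> \<delta> A"
    by eventually_elim (use d(2) hausdorff_content_antimono less_le_trans less_imp_le in blast)
next
  fix a assume a: "(SUP \<delta>\<in>{0<..}. hausdorff_content \<phi> \<delta> A) < a"
  have "\<forall>\<^sub>F \<delta> in at_right (0::real). \<delta> > 0"
    by (rule eventually_at_right_less)
  then show "\<forall>\<^sub>F \<delta> in at_right 0. hausdorff_content \<phi> \<delta> A < a"
    by eventually_elim (rule le_less_trans[OF SUP_upper a], simp)
qed

lemma hausdorff_measure_eq_SUP:
  "hausdorff_measure \<phi> A = (SUP \<delta>\<in>{0<..}. hausdorff_content \<phi> \<delta> A)"
  unfolding hausdorff_measure_def
  by (rule tendsto_Lim[OF _ hausdorff_content_tendsto_SUP]) simp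

(* Standard n-dimensional Brownian motion: the increment over [s, t] is centred
   Gaussian with covariance matrix (t - s) times the identity.  Only the values
   of B at times t >= 0 are constrained. *)
locale standard_brownian_motion = prob_space M
  for M :: "'a measure" and B :: "real \<Rightarrow> 'a \<Rightarrow> real ^ 'n" +
  assumes random_variable_B: "\<And>t. 0 \<le> t \<Longrightarrow> random_variable borel (B t)"
    and start_zero: "AE \<omega> in M. B 0 \<omega> = 0"
    and independent_increments:
      "\<And>t n. 0 \<le> t 0 \<Longrightarrow> (\<And>i. i < n \<Longrightarrow> t i \<le> t (Suc i)) \<Longrightarrow>
         indep_vars (\<lambda>_. borel) (\<lambda>i \<omega>. B (t (Suc i)) \<omega> - B (t i) \<omega>) {..<n::nat}"
    and gaussian_increments:
      "\<And>s t. 0 \<le> s \<Longrightarrow> s < t \<Longrightarrow>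
         distributed M lborel (\<lambda>\<omega>. B t \<omega> - B s \<omega>)
           (\<lambda>x. ennreal (\<Prod>i\<in>UNIV. normal_density 0 (sqrt (t - s)) (x $ i)))"
    and continuous_paths: "AE \<omega> in M. continuous_on {0..} (\<lambda>t. B t \<omega>)"

end

theory Submission
  imports Defs
begin

text \<open>
Fix a time horizon and scales: covering intervals of length $\varepsilon = 2^{-q}$, spatial
resolution $r = \varepsilon^7$, time step $h = \varepsilon^{56}$. For a fixed square of side of
order $r$, select greedily visits that are at least $\varepsilon$ apart. After each selected visit
the expected number of time steps spent in the square later than $\varepsilon$ is at most of order
$(r^2/h) \log (1/\varepsilon)$, whereas a further selected visit alone forces an
expected number at least of order $(r^2/h) \log (1/r)$; since $r$ is a large power of $\varepsilon$, the chance of a further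
visit is at most $1/2$. Hence the number of selected visits has a geometric tail, and a union
bound over the $O(r^{-2})$ squares of a grid with Borel-Cantelli shows that simultaneously all
level sets are covered by $O(\log (1/\varepsilon))$ intervals of length $\varepsilon$. The
modulus of continuity, from dyadic chaining, passes from the time grid to all times.
\<close>

section \<open>Greedy selection of visits\<close>

text \<open>The recursion consults earlier indices only, so whether \<open>i\<close> is selected is
  decided by \<open>H\<close> up to \<open>i\<close>. This adaptedness later lets selection be
  combined with independence of increments.\<close>

function spaced :: "nat \<Rightarrow> (nat \<Rightarrow> bool) \<Rightarrow> nat \<Rightarrow> bool" where
  "spaced m H i \<longleftrightarrow> H i \<and> (\<forall>l<i. i < l + m \<longrightarrow> \<not> spaced m H l)"
  by auto
termination by (relation "Wellfounded.measure (\<lambda>(m, H, i). i)") auto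

declare spaced.simps [simp del]

text \<open>Ranks start at 0. The selection of rank \<open>k\<close> is a relation and not a
  function because it may fail to exist; it plays the role of a stopping time.\<close>

definition spaced_rank :: "nat \<Rightarrow> (nat \<Rightarrow> bool) \<Rightarrow> nat \<Rightarrow> nat \<Rightarrow> bool" where
  "spaced_rank m H k i \<longleftrightarrow> spaced m H i \<and> card {l. l < i \<and> spaced m H l} = k"

lemma spaced_hit: "spaced m H i \<Longrightarrow> H i"
  by (subst (asm) spaced.simps) simp

lemma spaced_gap: "spaced m H l \<Longrightarrow> spaced m H i \<Longrightarrow> l < i \<Longrightarrow> l + m \<le> i"
  by (subst (asm) (2) spaced.simps) (meson not_le)

lemma spaced_cong: "(\<And>l. l \<le> i \<Longrightarrow> H l = H' l) \<Longrightarrow> spaced m H i = spaced m H' i"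
proof (induction i rule: less_induct)
  case (less i)
  have "\<And>l. l < i \<Longrightarrow> spaced m H l = spaced m H' l"
    using less by simp
  then show ?case
    using less.prems[of i] by (subst (1 2) spaced.simps) auto
qed

lemma spaced_rank_cong:
  assumes "\<And>l. l \<le> i \<Longrightarrow> H l = H' l"
  shows "spaced_rank m H k i = spaced_rank m H' k i"
proof -
  have "\<And>l. l \<le> i \<Longrightarrow> spaced m H l = spaced m H' l"
    using assms by (intro spaced_cong) auto
  then have "{l. l < i \<and> spaced m H l} = {l. l < i \<and> spaced m H' l}" "spaced m H i = spaced m H' i"
    by auto
  then show ?thesis
    by (simp add: spaced_rank_def)
qed

text \<open>A hit that is not selected is blocked by a selected one fewer than \<open>m\<close>
  indices earlier. Selected hits, each extended by \<open>m\<close> indices, therefore cover all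
  hits.\<close>

lemma ex_spaced_before_hit:
  assumes "H i" "0 < m"
  shows "\<exists>j\<le>i. spaced m H j \<and> i < j + m"
proof (cases "spaced m H i")
  case False
  then show ?thesis
    using assms by (subst (asm) spaced.simps) (auto intro: less_imp_le)
qed (use assms in auto)

lemma spaced_rank_unique:
  assumes "spaced_rank m H k i" "spaced_rank m H k j"
  shows "i = j"
proof -
  have False if ij: "i < j" "spaced_rank m H k i" "spaced_rank m H k j" for i j
  proof -
    have "{l. l < i \<and> spaced m H l} \<subset> {l. l < j \<and> spaced m H l}"
      using ij by (auto simp: spaced_rank_def)
    then have "card {l. l < i \<and> spaced m H l} < card {l. l < j \<and> spaced m H l}"
      by (intro psubset_card_mono) auto
    then show False
      using ij by (simp add: spaced_rank_def)
  qed
  then show ?thesis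
    using assms by (meson linorder_neqE_nat)
qed

lemma spaced_rank_exists:
  assumes "k < card {l. l \<le> n \<and> spaced m H l}"
  shows "\<exists>i\<le>n. spaced_rank m H k i"
  using assms
proof (induction n)
  case 0
  have "{l. l \<le> 0 \<and> spaced m H l} = (if spaced m H 0 then {0} else {})"
    by auto
  with 0 have "spaced m H 0" "k = 0"
    by (auto split: if_splits)
  then show ?case
    by (auto simp: spaced_rank_def)
next
  case (Suc n)
  show ?case
  proof (cases "k < card {l. l \<le> n \<and> spaced m H l}")
    case True
    then show ?thesis using Suc.IH by (auto intro: le_SucI)
  next
    case False
    have *: "{l. l \<le> Suc n \<and> spaced m H l} =
        (if spaced m H (Suc n) then insert (Suc n) {l. l \<le> n \<and> spaced m H l} else {l. l \<le> n \<and> spaced m H l})"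
      by (auto simp: le_Suc_eq)
    have "spaced m H (Suc n)" "k = card {l. l \<le> n \<and> spaced m H l}"
      using Suc.prems False unfolding * by (auto split: if_splits)
    then show ?thesis
      by (auto simp: spaced_rank_def less_Suc_eq_le)
  qed
qed

text \<open>Rank \<open>k\<close> is attained among the \<open>Suc k\<close> selections before
  \<open>i\<close>, and distinct selections are at least \<open>m\<close> apart. So each further
  selection is a late return after the previous one.\<close>

lemma spaced_rank_SucD:
  assumes "spaced_rank m H (Suc k) i"
  shows "\<exists>j. spaced_rank m H k j \<and> j + m \<le> i"
proof -
  have i: "spaced m H i" "card {l. l < i \<and> spaced m H l} = Suc k"
    using assms by (auto simp: spaced_rank_def)
  then obtain i' where i': "i = Suc i'"
    by (cases i) auto
  have "k < card {l. l \<le> i' \<and> spaced m H l}"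
    using i by (simp add: i' less_Suc_eq_le)
  then obtain j where "j \<le> i'" "spaced_rank m H k j"
    using spaced_rank_exists by blast
  then show ?thesis
    using i spaced_gap[of m H j i] by (auto simp: spaced_rank_def i')
qed

section \<open>Hausdorff content\<close>

text \<open>For each \<open>A n\<close> take a cover within \<open>e / 2^(n+1)\<close> of the
  infimum, then merge all covers into one sequence by the pairing of the naturals.\<close>

lemma hausdorff_content_countable_subadditive:
  "hausdorff_content \<phi> \<delta> (\<Union>n. A n) \<le> (\<Sum>n. hausdorff_content \<phi> \<delta> (A n))"
proof (rule ennreal_le_epsilon)
  fix e :: real
  assume e: "0 < e" and fin: "(\<Sum>n. hausdorff_content \<phi> \<delta> (A n)) < top"
  have "\<exists>E\<in>hausdorff_covers \<delta> (A n). (\<Sum>i. ennreal (\<phi> (diameter (E i)))) < hausdorff_content \<phi> \<delta> (A n) + ennreal (e * (1/2)^Suc n)" for n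
  proof -
    \<comment> \<open>Finiteness makes adding a positive amount a strict increase, which yields a
      near-optimal cover.\<close>
    have "hausdorff_content \<phi> \<delta> (A n) \<noteq> top"
      using fin ennreal_suminf_lessD less_top by blast
    then have "hausdorff_content \<phi> \<delta> (A n) < hausdorff_content \<phi> \<delta> (A n) + ennreal (e * (1/2)^Suc n)"
      using e by (simp add: ennreal_add_left_cancel_less[of _ 0, simplified])
    then show ?thesis
      unfolding hausdorff_content_def INF_less_iff .
  qed
  then obtain E where E: "\<And>n. E n \<in> hausdorff_covers \<delta> (A n)"
      "\<And>n. (\<Sum>i. ennreal (\<phi> (diameter (E n i)))) < hausdorff_content \<phi> \<delta> (A n) + ennreal (e * (1/2)^Suc n)"
    by metis
  define F where "F p = (case prod_decode p of (n, i) \<Rightarrow> E n i)" for p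
  have "F \<in> hausdorff_covers \<delta> (\<Union>n. A n)"
  proof -
    have "A n \<subseteq> (\<Union>p. F p)" for n
    proof
      fix x assume "x \<in> A n"
      then obtain i where "x \<in> E n i"
        using E(1)[of n] by (auto simp: hausdorff_covers_def)
      then have "x \<in> F (prod_encode (n, i))"
        by (simp add: F_def)
      then show "x \<in> (\<Union>p. F p)" by blast
    qed
    then show ?thesis
      using E(1) by (auto simp: hausdorff_covers_def F_def split: prod.split)
  qed
  then have "hausdorff_content \<phi> \<delta> (\<Union>n. A n) \<le> (\<Sum>p. ennreal (\<phi> (diameter (F p))))"
    unfolding hausdorff_content_def by (rule INF_lower)
  also have "\<dots> = (\<Sum>n. \<Sum>i. ennreal (\<phi> (diameter (E n i))))"
    using suminf_ennreal_2dimen[of "\<lambda>n. \<Sum>i. ennreal (\<phi> (diameter (E n i)))" "\<lambda>(n, i). ennreal (\<phi> (diameter (E n i)))"]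
    by (simp add: F_def case_prod_beta comp_def)
  also have "\<dots> \<le> (\<Sum>n. hausdorff_content \<phi> \<delta> (A n) + ennreal (e * (1/2)^Suc n))"
    using E(2) by (intro suminf_le) (auto intro: less_imp_le)
  also have "\<dots> = (\<Sum>n. hausdorff_content \<phi> \<delta> (A n)) + (\<Sum>n. ennreal (e * (1/2)^Suc n))"
    by (intro suminf_add[symmetric]) auto
  also have "(\<Sum>n. ennreal (e * (1/2)^Suc n)) = ennreal e"
    using e sums_mult[OF power_half_series, of e]
    by (intro suminf_ennreal_eq) auto
  finally show "hausdorff_content \<phi> \<delta> (\<Union>n. A n) \<le> (\<Sum>n. hausdorff_content \<phi> \<delta> (A n)) + ennreal e" .
qed

text \<open>Covers are infinite sequences of sets of positive diameter, so a finite family must be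
  padded. Since \<open>\<phi>\<close> tends to 0 at 0, the padding intervals can be so short that
  their gauge values sum to at most \<open>e\<close>.\<close>

lemma hausdorff_content_finite_cover:
  fixes \<phi> :: "real \<Rightarrow> real"
  assumes lim: "(\<phi> \<longlongrightarrow> 0) (at_right 0)" and d: "0 < d" "d < \<delta>" and J: "finite J"
    and cov: "A \<subseteq> (\<Union>j\<in>J. {s j .. s j + d})"
  shows "hausdorff_content \<phi> \<delta> A \<le> of_nat (card J) * ennreal (\<phi> d)"
proof (rule ennreal_le_epsilon)
  fix e :: real
  assume e: "0 < e"
  have "\<exists>c>0. c < \<delta> \<and> \<phi> c < e * (1/2)^Suc n" for n
  proof -
    have "\<forall>\<^sub>F c in at_right 0. \<phi> c < e * (1/2)^Suc n"
      using e by (intro order_tendstoD(2)[OF lim]) simp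
    moreover have "\<forall>\<^sub>F c in at_right (0::real). 0 < c \<and> c < \<delta>"
      using d by (intro eventually_at_rightI[of 0 \<delta>]) auto
    ultimately have "\<forall>\<^sub>F c in at_right 0. 0 < c \<and> c < \<delta> \<and> \<phi> c < e * (1/2)^Suc n"
      by eventually_elim auto
    then show ?thesis
      using eventually_happens[of _ "at_right (0::real)"] by auto
  qed
  then obtain c where c: "\<And>n. 0 < c n" "\<And>n. c n < \<delta>" "\<And>n. \<phi> (c n) < e * (1/2)^Suc n"
    by metis
  obtain f where f: "bij_betw f {..<card J} J"
    using J by (metis atLeast0LessThan ex_bij_betw_nat_finite)
  define E where "E i = (if i < card J then {s (f i) .. s (f i) + d} else {0..c (i - card J)})" for i
  have diam: "diameter (E i) = (if i < card J then d else c (i - card J))" for i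
    using d c(1)[of "i - card J"] by (auto simp: E_def)
  have "E \<in> hausdorff_covers \<delta> A"
  proof -
    have "A \<subseteq> (\<Union>i. E i)"
    proof
      fix x assume "x \<in> A"
      then obtain j where j: "j \<in> J" "x \<in> {s j .. s j + d}"
        using cov by auto
      then obtain i where "i < card J" "f i = j"
        using f unfolding bij_betw_def by (metis imageE lessThan_iff)
      then have "x \<in> E i"
        using j by (simp add: E_def)
      then show "x \<in> (\<Union>i. E i)" by blast
    qed
    moreover have "bounded (E i)" for i
      by (simp add: E_def)
    ultimately show ?thesis
      using d c by (auto simp: hausdorff_covers_def diam)
  qed
  then have "hausdorff_content \<phi> \<delta> A \<le> (\<Sum>i. ennreal (\<phi> (diameter (E i))))"
    unfolding hausdorff_content_def by (rule INF_lower)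
  also have "\<dots> = (\<Sum>i. ennreal (\<phi> (diameter (E (i + card J))))) + (\<Sum>i<card J. ennreal (\<phi> (diameter (E i))))"
    by (intro suminf_offset) auto
  also have "(\<Sum>i<card J. ennreal (\<phi> (diameter (E i)))) = of_nat (card J) * ennreal (\<phi> d)"
    by (simp add: diam)
  also have "(\<Sum>i. ennreal (\<phi> (diameter (E (i + card J))))) \<le> (\<Sum>n. ennreal (e * (1/2)^Suc n))"
    using c(3) by (intro suminf_le ennreal_leI) (auto simp: diam intro: less_imp_le)
  also have "(\<Sum>n. ennreal (e * (1/2)^Suc n)) = ennreal e"
    using e sums_mult[OF power_half_series, of e]
    by (intro suminf_ennreal_eq) auto
  finally show "hausdorff_content \<phi> \<delta> A \<le> of_nat (card J) * ennreal (\<phi> d) + ennreal e"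
    by (simp add: add.commute)
qed

section \<open>Gaussian increments and independence\<close>

text \<open>By independence the joint law is a product, so Fubini integrates the probability of the
  section at \<open>x\<close> against the law of \<open>X\<close>. A bound uniform over
  \<open>G\<close> thus passes to the joint event, which takes the place of conditioning on
  \<open>X\<close>.\<close>

lemma (in prob_space) indep_var_section_prob:
  assumes ind: "indep_var S X T Y" and G: "{x \<in> space S. G x} \<in> sets S"
    and Q: "{p \<in> space (S \<Otimes>\<^sub>M T). Q (fst p) (snd p)} \<in> sets (S \<Otimes>\<^sub>M T)"
  shows "(\<And>x. x \<in> space S \<Longrightarrow> G x \<Longrightarrow> prob {\<omega>\<in>space M. Q x (Y \<omega>)} \<le> u) \<Longrightarrow> 0 \<le> u \<Longrightarrow>
      prob {\<omega>\<in>space M. G (X \<omega>) \<and> Q (X \<omega>) (Y \<omega>)} \<le> prob {\<omega>\<in>space M. G (X \<omega>)} * u"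
    and "(\<And>x. x \<in> space S \<Longrightarrow> G x \<Longrightarrow> v \<le> prob {\<omega>\<in>space M. Q x (Y \<omega>)}) \<Longrightarrow>
      prob {\<omega>\<in>space M. G (X \<omega>)} * v \<le> prob {\<omega>\<in>space M. G (X \<omega>) \<and> Q (X \<omega>) (Y \<omega>)}"
proof -
  have X[measurable]: "X \<in> measurable M S" and Y[measurable]: "Y \<in> measurable M T"
    and D: "distr M S X \<Otimes>\<^sub>M distr M T Y = distr M (S \<Otimes>\<^sub>M T) (\<lambda>x. (X x, Y x))"
    using ind unfolding indep_var_distribution_eq by auto
  interpret T: prob_space "distr M T Y" by (rule prob_space_distr) fact
  note [measurable] = G Q
  define R where "R = {p \<in> space (S \<Otimes>\<^sub>M T). G (fst p) \<and> Q (fst p) (snd p)}"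
  have R[measurable]: "R \<in> sets (S \<Otimes>\<^sub>M T)"
    unfolding R_def by measurable
  have pairX: "X \<omega> \<in> space S" "Y \<omega> \<in> space T" if "\<omega> \<in> space M" for \<omega>
    using that measurable_space[OF X] measurable_space[OF Y] by auto
  have sec: "emeasure (distr M T Y) (Pair x -` R) = indicator {x \<in> space S. G x} x * prob {\<omega>\<in>space M. Q x (Y \<omega>)}"
    if "x \<in> space S" for x
  proof -
    have "emeasure (distr M T Y) (Pair x -` R) = emeasure M (Y -` (Pair x -` R) \<inter> space M)"
      using sets_Pair1[OF R] by (simp add: emeasure_distr)
    also have "Y -` (Pair x -` R) \<inter> space M = (if G x then {\<omega>\<in>space M. Q x (Y \<omega>)} else {})"
      using that pairX by (auto simp: R_def space_pair_measure)
    finally show ?thesis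
      using that by (auto simp: emeasure_eq_measure)
  qed
  have "emeasure M {\<omega>\<in>space M. G (X \<omega>) \<and> Q (X \<omega>) (Y \<omega>)} = emeasure (distr M (S \<Otimes>\<^sub>M T) (\<lambda>x. (X x, Y x))) R"
    by (subst emeasure_distr) (auto simp: R_def space_pair_measure pairX intro!: arg_cong[where f="emeasure M"])
  also have "\<dots> = (\<integral>\<^sup>+ x. emeasure (distr M T Y) (Pair x -` R) \<partial>distr M S X)"
    unfolding D[symmetric] by (intro T.emeasure_pair_measure_alt) simp
  also have "\<dots> = (\<integral>\<^sup>+ x. indicator {x \<in> space S. G x} x * prob {\<omega>\<in>space M. Q x (Y \<omega>)} \<partial>distr M S X)"
    by (intro nn_integral_cong) (simp add: sec)
  finally have eq: "emeasure M {\<omega>\<in>space M. G (X \<omega>) \<and> Q (X \<omega>) (Y \<omega>)} =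
    (\<integral>\<^sup>+ x. indicator {x \<in> space S. G x} x * prob {\<omega>\<in>space M. Q x (Y \<omega>)} \<partial>distr M S X)" .
  have GX: "emeasure (distr M S X) {x \<in> space S. G x} = prob {\<omega>\<in>space M. G (X \<omega>)}"
    by (subst emeasure_distr) (auto simp: emeasure_eq_measure pairX intro!: arg_cong[where f=prob])
  have const: "(\<integral>\<^sup>+ x. ennreal c * indicator {x \<in> space S. G x} x \<partial>distr M S X) = ennreal (prob {\<omega>\<in>space M. G (X \<omega>)} * c)" if "0 \<le> c" for c
    using that by (subst nn_integral_cmult_indicator) (auto simp: GX ennreal_mult' mult.commute)
  show "prob {\<omega>\<in>space M. G (X \<omega>) \<and> Q (X \<omega>) (Y \<omega>)} \<le> prob {\<omega>\<in>space M. G (X \<omega>)} * u"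
    if u: "\<And>x. x \<in> space S \<Longrightarrow> G x \<Longrightarrow> prob {\<omega>\<in>space M. Q x (Y \<omega>)} \<le> u" "0 \<le> u"
  proof -
    have "emeasure M {\<omega>\<in>space M. G (X \<omega>) \<and> Q (X \<omega>) (Y \<omega>)} \<le> (\<integral>\<^sup>+ x. ennreal u * indicator {x \<in> space S. G x} x \<partial>distr M S X)"
      unfolding eq using u by (intro nn_integral_mono) (auto simp: indicator_def intro!: ennreal_leI)
    then show ?thesis
      using u(2) by (simp add: const emeasure_eq_measure)
  qed
  assume v: "\<And>x. x \<in> space S \<Longrightarrow> G x \<Longrightarrow> v \<le> prob {\<omega>\<in>space M. Q x (Y \<omega>)}"
  show "prob {\<omega>\<in>space M. G (X \<omega>)} * v \<le> prob {\<omega>\<in>space M. G (X \<omega>) \<and> Q (X \<omega>) (Y \<omega>)}"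
  proof (cases "0 \<le> v")
    case True
    have "(\<integral>\<^sup>+ x. ennreal v * indicator {x \<in> space S. G x} x \<partial>distr M S X) \<le> emeasure M {\<omega>\<in>space M. G (X \<omega>) \<and> Q (X \<omega>) (Y \<omega>)}"
      unfolding eq using v by (intro nn_integral_mono) (auto simp: indicator_def intro!: ennreal_leI)
    then show ?thesis
      using True by (simp add: const emeasure_eq_measure)
  next
    case False
    then show ?thesis
      by (meson measure_nonneg mult_nonneg_nonpos order_trans le_cases)
  qed
qed

context standard_brownian_motion
begin

text \<open>This is the Markov property on a time grid. The past is recorded through increments;
  positions relative to the start are their partial sums.\<close>

lemma indep_past_increment:
  assumes h: "0 \<le> h" and "j < i"
  shows "indep_var (\<Pi>\<^sub>M l\<in>{..<j}. borel) (\<lambda>\<omega>. \<lambda>l\<in>{..<j}. B (real (Suc l) * h) \<omega> - B (real l * h) \<omega>)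
    (\<Pi>\<^sub>M l\<in>{j}. borel) (\<lambda>\<omega>. \<lambda>l\<in>{j}. B (real i * h) \<omega> - B (real j * h) \<omega>)"
proof -
  \<comment> \<open>The grid runs up to \<open>j * h\<close> and then jumps to \<open>i * h\<close>,
    so the increment with index \<open>j\<close> is the long one.\<close>
  define t where "t l = (if l \<le> j then real l else real i) * h" for l
  have "indep_vars (\<lambda>_. borel) (\<lambda>i \<omega>. B (t (Suc i)) \<omega> - B (t i) \<omega>) {..<Suc j}"
    using assms by (intro independent_increments) (auto simp: t_def intro!: mult_right_mono)
  then have "indep_var (\<Pi>\<^sub>M l\<in>{..<j}. borel) (\<lambda>\<omega>. \<lambda>l\<in>{..<j}. B (t (Suc l)) \<omega> - B (t l) \<omega>)
      (\<Pi>\<^sub>M l\<in>{j}. borel) (\<lambda>\<omega>. \<lambda>l\<in>{j}. B (t (Suc l)) \<omega> - B (t l) \<omega>)"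
    by (rule indep_var_restrict) auto
  also have "(\<lambda>\<omega>. \<lambda>l\<in>{..<j}. B (t (Suc l)) \<omega> - B (t l) \<omega>) = (\<lambda>\<omega>. \<lambda>l\<in>{..<j}. B (real (Suc l) * h) \<omega> - B (real l * h) \<omega>)"
    by (auto simp: t_def fun_eq_iff restrict_def)
  also have "(\<lambda>\<omega>. \<lambda>l\<in>{j}. B (t (Suc l)) \<omega> - B (t l) \<omega>) = (\<lambda>\<omega>. \<lambda>l\<in>{j}. B (real i * h) \<omega> - B (real j * h) \<omega>)"
    by (auto simp: t_def fun_eq_iff restrict_def)
  finally show ?thesis .
qed

end

locale planar_brownian_motion = standard_brownian_motion M B
  for M :: "'a measure" and B :: "real \<Rightarrow> 'a \<Rightarrow> real ^ 2"
begin

lemma prod_normal_density_2: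
  fixes x :: "real ^ 2"
  assumes "0 < t"
  shows "(\<Prod>i\<in>UNIV. normal_density 0 (sqrt t) (x $ i)) = exp (- (norm x)\<^sup>2 / (2 * t)) / (2 * pi * t)"
proof -
  have "(norm x)\<^sup>2 = (x $ 1)\<^sup>2 + (x $ 2)\<^sup>2"
    by (simp add: norm_vec_def L2_set_def sum_2)
  then show ?thesis
    using assms by (simp add: prod_2 UNIV_2 normal_density_def exp_add[symmetric] add_divide_distrib[symmetric] real_sqrt_mult[symmetric] field_simps)
qed

lemma increment_prob_eq:
  assumes "0 \<le> s" "s < t" and C: "C \<in> sets borel"
  shows "ennreal (prob {\<omega>\<in>space M. B t \<omega> - B s \<omega> \<in> C}) =
    (\<integral>\<^sup>+ x. ennreal (exp (- (norm x)\<^sup>2 / (2 * (t - s))) / (2 * pi * (t - s))) * indicator C x \<partial>lborel)"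
proof -
  have "{\<omega>\<in>space M. B t \<omega> - B s \<omega> \<in> C} = (\<lambda>\<omega>. B t \<omega> - B s \<omega>) -` C \<inter> space M"
    by auto
  then show ?thesis
    using distributed_emeasure[OF gaussian_increments[OF assms(1,2)], of C] C assms
    by (simp add: emeasure_eq_measure prod_normal_density_2)
qed

text \<open>The Gaussian density is largest at the origin, where it equals
  \<open>1 / (2 * pi * (t - s))\<close>.\<close>

lemma increment_prob_upper:
  assumes "0 \<le> s" "s < t" and C: "C \<in> sets borel" and a: "emeasure lborel C = ennreal a" "0 \<le> a"
  shows "prob {\<omega>\<in>space M. B t \<omega> - B s \<omega> \<in> C} \<le> a / (2 * pi * (t - s))"
proof -
  have "ennreal (prob {\<omega>\<in>space M. B t \<omega> - B s \<omega> \<in> C}) \<le> (\<integral>\<^sup>+ x. ennreal (1 / (2 * pi * (t - s))) * indicator C x \<partial>lborel)"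
    unfolding increment_prob_eq[OF assms(1-3)] using assms
    by (intro nn_integral_mono mult_right_mono ennreal_leI divide_right_mono) auto
  also have "\<dots> = ennreal (a / (2 * pi * (t - s)))"
    using C a assms(1,2) by (subst nn_integral_cmult_indicator) (auto simp: ennreal_mult'[symmetric])
  finally show ?thesis
    using assms by simp
qed

text \<open>On \<open>C\<close> the exponent of the Gaussian density is at least -1, so the density
  is at least \<open>exp (- 1)\<close> times its maximum.\<close>

lemma increment_prob_lower:
  assumes "0 \<le> s" "s < t" and C: "C \<in> sets borel" and a: "emeasure lborel C = ennreal a" "0 \<le> a"
    and "\<And>x. x \<in> C \<Longrightarrow> (norm x)\<^sup>2 \<le> 2 * (t - s)"
  shows "exp (- 1) * a / (2 * pi * (t - s)) \<le> prob {\<omega>\<in>space M. B t \<omega> - B s \<omega> \<in> C}"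
proof -
  have "ennreal (exp (-1) * a / (2 * pi * (t - s))) = (\<integral>\<^sup>+ x. ennreal (exp (-1) / (2 * pi * (t - s))) * indicator C x \<partial>lborel)"
    using C a assms(1,2) by (subst nn_integral_cmult_indicator) (auto simp: ennreal_mult'[symmetric])
  also have "\<dots> \<le> ennreal (prob {\<omega>\<in>space M. B t \<omega> - B s \<omega> \<in> C})"
    unfolding increment_prob_eq[OF assms(1-3)] using assms
    by (intro nn_integral_mono) (auto simp: indicator_def intro!: ennreal_leI divide_right_mono)
  finally show ?thesis
    by simp
qed

text \<open>Off the ball of radius \<open>c\<close>, the Gaussian density of variance \<open>d\<close> is at most \<open>2 exp (- c\<^sup>2 / 4d)\<close>
  times the density of variance \<open>2d\<close>, which integrates to one.\<close>

lemma increment_tail: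
  assumes "0 \<le> s" "s < t" "0 \<le> c"
  shows "prob {\<omega>\<in>space M. c < norm (B t \<omega> - B s \<omega>)} \<le> 2 * exp (- c\<^sup>2 / (4 * (t - s)))"
proof -
  define d where "d = t - s"
  have d: "0 < d" using assms by (simp add: d_def)
  have C[measurable]: "{x::real^2. c < norm x} \<in> sets borel"
    by measurable
  have "ennreal (prob {\<omega>\<in>space M. c < norm (B t \<omega> - B s \<omega>)}) =
    (\<integral>\<^sup>+ x. ennreal (exp (- (norm x)\<^sup>2 / (2 * d)) / (2 * pi * d)) * indicator {x::real^2. c < norm x} x \<partial>lborel)"
    using increment_prob_eq[OF assms(1,2) C] by (simp add: d_def)
  also have "\<dots> \<le> (\<integral>\<^sup>+ x. ennreal (2 * exp (- c\<^sup>2 / (4 * d))) * (ennreal (exp (- (norm (x::real^2))\<^sup>2 / (2 * (2 * d))) / (2 * pi * (2 * d))) * indicator UNIV x) \<partial>lborel)"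
  proof (intro nn_integral_mono)
    fix x :: "real^2"
    have "exp (- (norm x)\<^sup>2 / (2 * d)) / (2 * pi * d) \<le> 2 * exp (- c\<^sup>2 / (4 * d)) * (exp (- (norm x)\<^sup>2 / (2 * (2 * d))) / (2 * pi * (2 * d)))"
      if "c < norm x"
    proof -
      have "c\<^sup>2 \<le> (norm x)\<^sup>2"
        using that assms(3) by (intro power_mono) auto
      then have "exp (- (norm x)\<^sup>2 / (2 * d)) \<le> exp (- c\<^sup>2 / (4 * d)) * exp (- (norm x)\<^sup>2 / (2 * (2 * d)))"
        using d by (simp add: exp_add[symmetric] field_simps)
      then show ?thesis
        using d by (simp add: field_simps)
    qed
    then show "ennreal (exp (- (norm x)\<^sup>2 / (2 * d)) / (2 * pi * d)) * indicator {x::real^2. c < norm x} x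
       \<le> ennreal (2 * exp (- c\<^sup>2 / (4 * d))) * (ennreal (exp (- (norm (x::real^2))\<^sup>2 / (2 * (2 * d))) / (2 * pi * (2 * d))) * indicator UNIV x)"
      using d by (auto simp: indicator_def ennreal_mult'[symmetric] simp del: times_divide_eq_right intro!: ennreal_leI)
  qed
  \<comment> \<open>The density of variance \<open>2 * d\<close> belongs to the increment over
    \<open>[0, 2 * d]\<close>, so its total mass is the probability of the sure event.\<close>
  also have "\<dots> = ennreal (2 * exp (- c\<^sup>2 / (4 * d))) * ennreal (prob {\<omega>\<in>space M. B (2 * d) \<omega> - B 0 \<omega> \<in> UNIV})"
    using d increment_prob_eq[of 0 "2 * d" UNIV] by (subst nn_integral_cmult) auto
  also have "\<dots> = ennreal (2 * exp (- c\<^sup>2 / (4 * d)))"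
    by (simp add: prob_space)
  finally show ?thesis
    by (simp add: d_def)
qed

end

section \<open>Visits to a small square\<close>

text \<open>Only the truth values of \<open>H w\<close> up to \<open>j\<close> matter, so the event
  is a finite union, over the patterns \<open>P\<close> accepted by \<open>G\<close>, of finite
  intersections.\<close>

lemma sets_Collect_finite_pattern:
  fixes G :: "(nat \<Rightarrow> bool) \<Rightarrow> bool"
  assumes H: "\<And>l. l \<le> j \<Longrightarrow> {w \<in> space S. H w l} \<in> sets S"
    and G: "\<And>H H'. (\<And>l. l \<le> j \<Longrightarrow> H l = H' l) \<Longrightarrow> G H = G H'"
  shows "{w \<in> space S. G (H w)} \<in> sets S"
proof -
  have "G (H w) \<longleftrightarrow> (\<exists>P\<in>{P\<in>Pow {..j}. G (\<lambda>l. l \<in> P)}. \<forall>l\<in>{..j}. H w l \<longleftrightarrow> l \<in> P)" for w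
  proof
    assume "G (H w)"
    moreover have "G (H w) = G (\<lambda>l. l \<in> {l. l \<le> j \<and> H w l})"
      by (rule G) auto
    ultimately show "\<exists>P\<in>{P\<in>Pow {..j}. G (\<lambda>l. l \<in> P)}. \<forall>l\<in>{..j}. H w l \<longleftrightarrow> l \<in> P"
      by (intro bexI[of _ "{l. l \<le> j \<and> H w l}"]) auto
  next
    assume "\<exists>P\<in>{P\<in>Pow {..j}. G (\<lambda>l. l \<in> P)}. \<forall>l\<in>{..j}. H w l \<longleftrightarrow> l \<in> P"
    then obtain P where P: "G (\<lambda>l. l \<in> P)" "\<And>l. l \<le> j \<Longrightarrow> H w l = (l \<in> P)"
      by auto
    then show "G (H w)"
      using G[of "H w" "\<lambda>l. l \<in> P"] by blast
  qed
  moreover have "{w \<in> space S. \<exists>P\<in>{P\<in>Pow {..j}. G (\<lambda>l. l \<in> P)}. \<forall>l\<in>{..j}. H w l \<longleftrightarrow> l \<in> P} \<in> sets S"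
  proof -
    have *: "{w \<in> space S. H w l \<longleftrightarrow> l \<in> P} \<in> sets S" if "l \<le> j" for l P
      using H[OF that] sets.sets_Collect_neg[OF H[OF that]] by (cases "l \<in> P") simp_all
    have fin: "finite {P \<in> Pow {..j}. G (\<lambda>l. l \<in> P)}"
      by (rule finite_subset[of _ "Pow {..j}"]) auto
    show ?thesis
      using * by (intro sets.sets_Collect_finite_Ex[OF _ fin] sets.sets_Collect_finite_All') auto
  qed
  ultimately show ?thesis
    by simp
qed

text \<open>The block from \<open>2^b\<close> to \<open>2^(b+1)\<close> has \<open>2^b\<close>
  terms, each between \<open>1 / 2^(b+1)\<close> and \<open>1 / 2^b\<close>, and so contributes
  between 1/2 and 1. These sums are the logarithms in the visit counts.\<close>

lemma sum_inverse_dyadic: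
  assumes "a \<le> b"
  shows "(\<Sum>d\<in>{2^a..<2^b}. 1 / real d) \<le> real b - real a" (is ?U)
    and "(real b - real a) / 2 \<le> (\<Sum>d\<in>{2^a..<2^b}. 1 / real d)" (is ?L)
proof -
  have "?U \<and> ?L"
    using assms
  proof (induction b rule: dec_induct)
    case (step b)
    have split: "{2^a..<2^Suc b} = {2^a..<2^b} \<union> {2^b..<2^Suc b::nat}"
      using power_increasing[OF step.hyps(1), of "2::nat"] by (intro ivl_disj_un_two(3)[symmetric]) auto
    have *: "(\<Sum>d\<in>{2^a..<2^Suc b}. 1 / real d) = (\<Sum>d\<in>{2^a..<2^b}. 1 / real d) + (\<Sum>d\<in>{2^b..<2^Suc b}. 1 / real d)"
      unfolding split by (rule sum.union_disjoint) auto
    have le: "1 / real d \<le> 1 / 2^b" and ge: "1 / 2^Suc b \<le> 1 / real d" if "d \<in> {2^b..<2^Suc b}" for d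
    proof -
      have "real (2^b) \<le> real d" "real d \<le> real (2^Suc b)"
        using that by (auto simp del: of_nat_power power_Suc intro: less_imp_le)
      moreover have "0 < real d"
        using that by (auto intro: gr0I)
      ultimately show "1 / real d \<le> 1 / 2^b" "1 / 2^Suc b \<le> 1 / real d"
        by (auto intro!: divide_left_mono simp del: power_Suc)
    qed
    have "(\<Sum>d\<in>{2^b..<2^Suc b}. 1 / real d) \<le> of_nat (card {2^b..<2^Suc b::nat}) * (1 / 2^b)"
      using le by (rule sum_bounded_above)
    moreover have "of_nat (card {2^b..<2^Suc b::nat}) * (1 / 2^Suc b) \<le> (\<Sum>d\<in>{2^b..<2^Suc b}. 1 / real d)"
      using ge by (rule sum_bounded_below)
    ultimately have "(\<Sum>d\<in>{2^b..<2^Suc b}. 1 / real d) \<le> 1" "1 / 2 \<le> (\<Sum>d\<in>{2^b..<2^Suc b}. 1 / real d)"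
      by simp_all
    then show ?case
      using step.IH unfolding * by auto
  qed simp
  then show ?U ?L by auto
qed

section \<open>Squares and the probability of hitting them given the past\<close>

definition square :: "real ^ 2 \<Rightarrow> real \<Rightarrow> (real ^ 2) set" where
  "square z a = {y. \<forall>i. \<bar>y $ i - z $ i\<bar> \<le> a}"

lemma square_eq_cbox: "square z a = cbox (\<chi> i. z $ i - a) (\<chi> i. z $ i + a)"
  by (auto simp: square_def cbox_interval less_eq_vec_def abs_le_iff algebra_simps)

lemma sets_square [measurable, simp]: "square z a \<in> sets borel"
  by (simp add: square_eq_cbox)

lemma emeasure_square: "0 \<le> a \<Longrightarrow> emeasure lborel (square z a) = ennreal (4 * a\<^sup>2)"
  by (subst square_eq_cbox) (simp add: emeasure_lborel_cbox_eq Basis_vec_def inner_axis power2_eq_square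
      UNIV_2 axis_eq_axis)

context planar_brownian_motion
begin

text \<open>Positions are taken relative to \<open>B 0\<close>, which vanishes only almost surely;
  in this form a hit is a function of the increments at every sample point.\<close>

definition hits :: "real \<Rightarrow> real ^ 2 \<Rightarrow> real \<Rightarrow> 'a \<Rightarrow> nat \<Rightarrow> bool" where
  "hits h z a \<omega> l \<longleftrightarrow> B (real l * h) \<omega> - B 0 \<omega> \<in> square z a"

lemma sets_hits [measurable, simp]:
  assumes "0 \<le> h"
  shows "{\<omega> \<in> space M. hits h z a \<omega> l} \<in> sets M"
proof -
  have [measurable]: "B 0 \<in> borel_measurable M" "B (real l * h) \<in> borel_measurable M"
    using assms by (auto intro!: random_variable_B)
  show ?thesis
    unfolding hits_def by measurable
qed

text \<open>Given the increments before \<open>j\<close>, a hit at \<open>i\<close> means that the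
  increment from \<open>j * h\<close> to \<open>i * h\<close> lands in a translated square of area
  \<open>4 * a\<^sup>2\<close>, and the Gaussian density bounds apply. For the lower bound, a hit at
  \<open>j\<close> keeps that translated square near the origin.\<close>

lemma
  fixes G :: "(nat \<Rightarrow> bool) \<Rightarrow> bool"
  assumes h: "0 < h" and a: "0 \<le> a" and ji: "j < i"
    and G: "\<And>H H'. (\<And>l. l \<le> j \<Longrightarrow> H l = H' l) \<Longrightarrow> G H = G H'"
  shows hit_prob_upper: "prob {\<omega>\<in>space M. G (hits h z a \<omega>) \<and> hits h z a \<omega> i}
      \<le> prob {\<omega>\<in>space M. G (hits h z a \<omega>)} * (4 * a\<^sup>2 / (2 * pi * h) * (1 / (real i - real j)))"
    and hit_prob_lower: "(\<And>H. G H \<Longrightarrow> H j) \<Longrightarrow> 4 * a\<^sup>2 \<le> (real i - real j) * h \<Longrightarrow>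
      prob {\<omega>\<in>space M. G (hits h z a \<omega>)} * (exp (- 1) * (4 * a\<^sup>2 / (2 * pi * h)) * (1 / (real i - real j)))
      \<le> prob {\<omega>\<in>space M. G (hits h z a \<omega>) \<and> hits h z a \<omega> i}"
proof -
  let ?S = "\<Pi>\<^sub>M l\<in>{..<j}. (borel :: (real^2) measure)"
  let ?T = "\<Pi>\<^sub>M l\<in>{j}. (borel :: (real^2) measure)"
  define X where "X \<omega> = (\<lambda>l\<in>{..<j}. B (real (Suc l) * h) \<omega> - B (real l * h) \<omega>)" for \<omega>
  define Y where "Y \<omega> = (\<lambda>l\<in>{j}. B (real i * h) \<omega> - B (real j * h) \<omega>)" for \<omega>
  \<comment> \<open>Partial sums of increments restore the positions, so \<open>H\<close> and
    \<open>Q\<close> express hits as functions of the two independent variables.\<close>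
  define H where "H w l \<longleftrightarrow> (\<Sum>p<l. w p) \<in> square z a" for w :: "nat \<Rightarrow> real^2" and l
  define Q where "Q w v \<longleftrightarrow> (\<Sum>p<j. w p) + v j \<in> square z a" for w v :: "nat \<Rightarrow> real^2"
  have ind: "indep_var ?S X ?T Y"
    unfolding X_def Y_def using h ji by (intro indep_past_increment) auto
  have sumX: "(\<Sum>p<l. X \<omega> p) = B (real l * h) \<omega> - B 0 \<omega>" if "l \<le> j" for \<omega> l
  proof -
    have "(\<Sum>p<l. X \<omega> p) = (\<Sum>p<l. B (real (Suc p) * h) \<omega> - B (real p * h) \<omega>)"
      using that by (intro sum.cong) (auto simp: X_def)
    then show ?thesis
      using sum_lessThan_telescope[of "\<lambda>p. B (real p * h) \<omega>" l] by simp
  qed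
  have GX: "G (H (X \<omega>)) \<longleftrightarrow> G (hits h z a \<omega>)" for \<omega>
    by (rule G) (simp add: H_def hits_def sumX)
  have QX: "Q (X \<omega>) (Y \<omega>) \<longleftrightarrow> hits h z a \<omega> i" for \<omega>
    by (simp add: Q_def hits_def sumX Y_def)
  have Gs: "{w \<in> space ?S. G (H w)} \<in> sets ?S"
    by (rule sets_Collect_finite_pattern[of j, OF _ G]) (auto simp: H_def)
  have Qs: "{p \<in> space (?S \<Otimes>\<^sub>M ?T). Q (fst p) (snd p)} \<in> sets (?S \<Otimes>\<^sub>M ?T)"
    unfolding Q_def by measurable
  have lt: "0 \<le> real j * h" "real j * h < real i * h"
    using h ji by auto
  have tr: "{\<omega>\<in>space M. Q w (Y \<omega>)} = {\<omega>\<in>space M. B (real i * h) \<omega> - B (real j * h) \<omega> \<in> square (z - (\<Sum>p<j. w p)) a}" for w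
    by (auto simp: Q_def Y_def square_def algebra_simps)
  have area: "4 * a\<^sup>2 / (2 * pi * (real i * h - real j * h)) = 4 * a\<^sup>2 / (2 * pi * h) * (1 / (real i - real j))"
    by (simp add: left_diff_distrib[symmetric] del: mult_divide_mult_cancel_left_if)
  have pos: "0 < real i - real j"
    using ji by simp
  show "prob {\<omega>\<in>space M. G (hits h z a \<omega>) \<and> hits h z a \<omega> i}
      \<le> prob {\<omega>\<in>space M. G (hits h z a \<omega>)} * (4 * a\<^sup>2 / (2 * pi * h) * (1 / (real i - real j)))"
  proof (rule indep_var_section_prob(1)[OF ind Gs Qs, unfolded GX QX])
    show "prob {\<omega>\<in>space M. Q w (Y \<omega>)} \<le> 4 * a\<^sup>2 / (2 * pi * h) * (1 / (real i - real j))" for w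
      unfolding tr area[symmetric] using a by (intro increment_prob_upper[OF lt sets_square emeasure_square]) auto
  qed (use h pos in simp)
  assume GH: "\<And>H. G H \<Longrightarrow> H j" and large: "4 * a\<^sup>2 \<le> (real i - real j) * h"
  show "prob {\<omega>\<in>space M. G (hits h z a \<omega>)} * (exp (- 1) * (4 * a\<^sup>2 / (2 * pi * h)) * (1 / (real i - real j)))
      \<le> prob {\<omega>\<in>space M. G (hits h z a \<omega>) \<and> hits h z a \<omega> i}"
  proof (rule indep_var_section_prob(2)[OF ind Gs Qs, unfolded GX QX])
    fix w assume "G (H w)"
    then have w: "(\<Sum>p<j. w p) \<in> square z a"
      using GH[OF \<open>G (H w)\<close>] by (simp add: H_def)
    \<comment> \<open>Both positions lie in the square, so each coordinate of the increment is at
      most \<open>2 * a\<close> in absolute value and its squared norm is at most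
      \<open>8 * a\<^sup>2\<close>.\<close>
    have small: "(norm x)\<^sup>2 \<le> 2 * (real i * h - real j * h)" if "x \<in> square (z - (\<Sum>p<j. w p)) a" for x
    proof -
      have "\<bar>x $ i\<bar> \<le> 2 * a" for i
      proof -
        have "\<bar>x $ i - (z - (\<Sum>p<j. w p)) $ i\<bar> \<le> a" "\<bar>(\<Sum>p<j. w p) $ i - z $ i\<bar> \<le> a"
          using that w unfolding square_def by blast+
        then show ?thesis
          by (simp only: vector_minus_component)
      qed
      then have "(x $ i)\<^sup>2 \<le> (2 * a)\<^sup>2" for i
        by (metis abs_ge_zero power2_abs power_mono)
      then have "(x $ 1)\<^sup>2 + (x $ 2)\<^sup>2 \<le> (2 * a)\<^sup>2 + (2 * a)\<^sup>2"
        by (intro add_mono)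
      then show ?thesis
        using large by (simp add: norm_vec_def L2_set_def sum_2 left_diff_distrib power_mult_distrib)
    qed
    have "exp (-1) * (4 * a\<^sup>2) / (2 * pi * (real i * h - real j * h)) \<le> prob {\<omega>\<in>space M. Q w (Y \<omega>)}"
      unfolding tr using small a by (intro increment_prob_lower[OF lt sets_square emeasure_square]) auto
    then show "exp (- 1) * (4 * a\<^sup>2 / (2 * pi * h)) * (1 / (real i - real j)) \<le> prob {\<omega>\<in>space M. Q w (Y \<omega>)}"
      unfolding mult.assoc[of "exp (- 1)"] area[symmetric] by (simp only: times_divide_eq_right)
  qed
qed

section \<open>Geometric tail for the number of selected visits\<close>

abbreviation rank_event :: "nat \<Rightarrow> real \<Rightarrow> real ^ 2 \<Rightarrow> real \<Rightarrow> nat \<Rightarrow> nat \<Rightarrow> 'a set" where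
  "rank_event m h z a k i \<equiv> {\<omega>\<in>space M. spaced_rank m (hits h z a \<omega>) k i}"

lemma sets_rank_event [measurable]: "0 \<le> h \<Longrightarrow> rank_event m h z a k i \<in> sets M"
  by (rule sets_Collect_finite_pattern[of i, OF _ spaced_rank_cong]) auto

lemma disjoint_rank_event: "disjoint_family_on (rank_event m h z a k) I"
  by (auto simp: disjoint_family_on_def dest: spaced_rank_unique)

text \<open>Both sides compare with the expected number of visits, within \<open>2n\<close> steps, that come at least
  \<open>m\<close> steps after the selected visit of rank \<open>k\<close>.\<close>

lemma return_step:
  fixes z :: "real ^ 2" and n :: nat
  assumes h: "0 < h" and a: "0 < a" and m: "0 < m" and s: "0 < s" and sep: "4 * a\<^sup>2 \<le> real s * h"
  defines "P \<equiv> \<lambda>k. \<Sum>i\<le>n. prob (rank_event m h z a k i)"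
  shows "P (Suc k) * (exp (- 1) * (\<Sum>d\<in>{s..n}. 1 / real d)) \<le> P k * (\<Sum>d\<in>{m..2*n}. 1 / real d)"
proof -
  \<comment> \<open>Square area over \<open>2 * pi * h\<close>: the chance of a hit \<open>d\<close>
    steps after a given visit is at most \<open>c / d\<close>, and at least
    \<open>exp (- 1) * c / d\<close> once \<open>s \<le> d\<close>. The factor \<open>c\<close>
    cancels at the end.\<close>
  define c where "c = 4 * a\<^sup>2 / (2 * pi * h)"
  have c: "0 < c"
    using h a by (simp add: c_def)
  define F where "F = rank_event m h z a"
  define V where "V i = {\<omega>\<in>space M. hits h z a \<omega> i}" for i
  have [measurable]: "F k i \<in> sets M" "V i \<in> sets M" for k i
    using h by (auto simp: F_def V_def sets_rank_event)
  have disj: "disjoint_family_on (\<lambda>i. F k i \<inter> V t) I" for k t I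
    using disjoint_rank_event[of m h z a k I] unfolding F_def disjoint_family_on_def by blast
  have FV: "F k i \<inter> V t = {\<omega>\<in>space M. spaced_rank m (hits h z a \<omega>) k i \<and> hits h z a \<omega> t}" for k i t
    by (auto simp: F_def V_def)
  have upper: "prob (F k i \<inter> V t) \<le> prob (F k i) * (c * (1 / (real t - real i)))" if "i < t" for k i t
    unfolding FV unfolding F_def c_def
    by (rule hit_prob_upper[where G = "\<lambda>H. spaced_rank m H k i", OF h less_imp_le[OF a] that])
      (rule spaced_rank_cong)
  have lower: "prob (F k i) * (exp (- 1) * c * (1 / real d)) \<le> prob (F k i \<inter> V (i + d))" if "s \<le> d" for k i d
  proof -
    have "real s * h \<le> real d * h"
      using that h by simp
    then have "4 * a\<^sup>2 \<le> (real (i + d) - real i) * h"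
      using sep by simp
    moreover have "i < i + d"
      using that s by simp
    ultimately have "prob (F k i) * (exp (- 1) * c * (1 / (real (i + d) - real i))) \<le> prob (F k i \<inter> V (i + d))"
      unfolding FV unfolding F_def c_def
      by (intro hit_prob_lower[where G = "\<lambda>H. spaced_rank m H k i", OF h less_imp_le[OF a]])
        (auto simp: spaced_rank_def spaced_hit intro!: spaced_rank_cong[unfolded spaced_rank_def])
    then show ?thesis
      by simp
  qed
  have "P (Suc k) * (exp (- 1) * c * (\<Sum>d\<in>{s..n}. 1 / real d)) =
      (\<Sum>i\<le>n. \<Sum>d\<in>{s..n}. prob (F (Suc k) i) * (exp (- 1) * c * (1 / real d)))"
    by (simp only: P_def F_def sum_distrib_left[of "exp (- 1) * c"] sum_product)
  \<comment> \<open>Lags of at most \<open>n\<close> after a visit at \<open>i \<le> n\<close> end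
    by time \<open>2 * n\<close>, which is why the horizon is doubled; \<open>t\<close> stands for
    \<open>i + d\<close>.\<close>
  also have "\<dots> \<le> (\<Sum>i\<le>n. \<Sum>t\<in>{t\<in>{..2*n}. i \<le> t}. prob (F (Suc k) i \<inter> V t))"
  proof (rule sum_mono)
    fix i assume i: "i \<in> {..n}"
    have "(\<Sum>d\<in>{s..n}. prob (F (Suc k) i) * (exp (- 1) * c * (1 / real d)))
        \<le> (\<Sum>d\<in>{s..n}. prob (F (Suc k) i \<inter> V (i + d)))"
      using lower by (intro sum_mono) auto
    also have "\<dots> = (\<Sum>t\<in>(\<lambda>d. i + d) ` {s..n}. prob (F (Suc k) i \<inter> V t))"
      by (subst sum.reindex) (auto simp: inj_on_def)
    also have "\<dots> \<le> (\<Sum>t\<in>{t\<in>{..2*n}. i \<le> t}. prob (F (Suc k) i \<inter> V t))"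
      using i by (intro sum_mono2) auto
    finally show "(\<Sum>d\<in>{s..n}. prob (F (Suc k) i) * (exp (- 1) * c * (1 / real d)))
        \<le> (\<Sum>t\<in>{t\<in>{..2*n}. i \<le> t}. prob (F (Suc k) i \<inter> V t))" .
  qed
  also have "\<dots> = (\<Sum>t\<le>2*n. \<Sum>i\<in>{i\<in>{..n}. i \<le> t}. prob (F (Suc k) i \<inter> V t))"
    by (rule sum.swap_restrict) auto
  \<comment> \<open>For fixed \<open>t\<close> the events of one rank are disjoint, so each inner
    sum is the probability of a union. A visit of rank \<open>Suc k\<close> by time \<open>t\<close>
    is preceded by one of rank \<open>k\<close> at least \<open>m\<close> steps earlier, which gives
    inclusion of the unions.\<close>
  also have "\<dots> \<le> (\<Sum>t\<le>2*n. \<Sum>j\<in>{j\<in>{..n}. j + m \<le> t}. prob (F k j \<inter> V t))"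
  proof (rule sum_mono)
    fix t
    have "(\<Sum>i\<in>{i\<in>{..n}. i \<le> t}. prob (F (Suc k) i \<inter> V t)) = prob (\<Union>i\<in>{i\<in>{..n}. i \<le> t}. F (Suc k) i \<inter> V t)"
      using disj by (intro finite_measure_finite_Union[symmetric]) auto
    also have "\<dots> \<le> prob (\<Union>j\<in>{j\<in>{..n}. j + m \<le> t}. F k j \<inter> V t)"
    proof (rule finite_measure_mono)
      show "(\<Union>i\<in>{i\<in>{..n}. i \<le> t}. F (Suc k) i \<inter> V t) \<subseteq> (\<Union>j\<in>{j\<in>{..n}. j + m \<le> t}. F k j \<inter> V t)"
      proof
        fix \<omega>
        assume "\<omega> \<in> (\<Union>i\<in>{i\<in>{..n}. i \<le> t}. F (Suc k) i \<inter> V t)"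
        then obtain i where i: "i \<le> n" "i \<le> t" "\<omega> \<in> space M" "spaced_rank m (hits h z a \<omega>) (Suc k) i" "\<omega> \<in> V t"
          by (auto simp: F_def)
        then obtain j where "spaced_rank m (hits h z a \<omega>) k j" "j + m \<le> i"
          using spaced_rank_SucD by blast
        with i show "\<omega> \<in> (\<Union>j\<in>{j\<in>{..n}. j + m \<le> t}. F k j \<inter> V t)"
          by (intro UN_I[of j]) (auto simp: F_def)
      qed
    qed measurable
    also have "\<dots> = (\<Sum>j\<in>{j\<in>{..n}. j + m \<le> t}. prob (F k j \<inter> V t))"
      using disj by (intro finite_measure_finite_Union) auto
    finally show "(\<Sum>i\<in>{i\<in>{..n}. i \<le> t}. prob (F (Suc k) i \<inter> V t)) \<le> (\<Sum>j\<in>{j\<in>{..n}. j + m \<le> t}. prob (F k j \<inter> V t))" .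
  qed
  also have "\<dots> = (\<Sum>j\<le>n. \<Sum>t\<in>{t\<in>{..2*n}. j + m \<le> t}. prob (F k j \<inter> V t))"
    by (rule sum.swap_restrict) auto
  also have "\<dots> \<le> (\<Sum>j\<le>n. \<Sum>d\<in>{m..2*n}. prob (F k j) * (c * (1 / real d)))"
  proof (rule sum_mono)
    fix j assume j: "j \<in> {..n}"
    have "(\<Sum>t\<in>{t\<in>{..2*n}. j + m \<le> t}. prob (F k j \<inter> V t))
        \<le> (\<Sum>t\<in>{t\<in>{..2*n}. j + m \<le> t}. prob (F k j) * (c * (1 / (real t - real j))))"
      using m by (intro sum_mono upper) auto
    also have "\<dots> \<le> (\<Sum>t\<in>(\<lambda>d. j + d) ` {m..2*n}. prob (F k j) * (c * (1 / (real t - real j))))"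
    proof (rule sum_mono2)
      show "{t\<in>{..2*n}. j + m \<le> t} \<subseteq> (\<lambda>d. j + d) ` {m..2*n}"
      proof
        fix t assume "t \<in> {t\<in>{..2*n}. j + m \<le> t}"
        then show "t \<in> (\<lambda>d. j + d) ` {m..2*n}"
          by (intro image_eqI[of _ _ "t - j"]) auto
      qed
    qed (use c in auto)
    also have "\<dots> = (\<Sum>d\<in>{m..2*n}. prob (F k j) * (c * (1 / real d)))"
      by (subst sum.reindex) (auto simp: inj_on_def)
    finally show "(\<Sum>t\<in>{t\<in>{..2*n}. j + m \<le> t}. prob (F k j \<inter> V t))
        \<le> (\<Sum>d\<in>{m..2*n}. prob (F k j) * (c * (1 / real d)))" .
  qed
  also have "\<dots> = P k * (c * (\<Sum>d\<in>{m..2*n}. 1 / real d))"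
    by (simp only: P_def F_def sum_distrib_left[of c] sum_product)
  finally have "c * (P (Suc k) * (exp (- 1) * (\<Sum>d\<in>{s..n}. 1 / real d))) \<le> c * (P k * (\<Sum>d\<in>{m..2*n}. 1 / real d))"
    by (simp add: mult_ac)
  then show ?thesis
    using c by (simp only: mult_le_cancel_left_pos)
qed

text \<open>The dyadic harmonic bounds and \<open>exp (- 1) \<ge> 1/3\<close> turn the return
  estimate into \<open>P (Suc k) * (\<gamma> - \<beta>) / 6 \<le> P k * (\<gamma> + 2 -
  \<alpha>)\<close>. The last assumption on the exponents bounds the right side by
  \<open>P k * (\<gamma> - \<beta>) / 12\<close>, so each further rank costs a factor 1/2.\<close>

lemma many_spaced_hits_prob:
  fixes z :: "real ^ 2" and \<alpha> \<beta> \<gamma> :: nat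
  assumes h: "0 < h" and a: "0 < a" and sep: "4 * a\<^sup>2 \<le> 2^\<beta> * h"
    and exps: "\<alpha> \<le> \<gamma>" "\<beta> < \<gamma>" "12 * (real \<gamma> + 2 - real \<alpha>) \<le> real \<gamma> - real \<beta>"
  shows "prob {\<omega>\<in>space M. k < card {i. i \<le> 2^\<gamma> \<and> spaced (2^\<alpha>) (hits h z a \<omega>) i}} \<le> (1/2)^k"
proof -
  \<comment> \<open>By disjointness, \<open>P k\<close> is the probability that a visit of rank
    \<open>k\<close> occurs by step \<open>2^\<gamma>\<close>.\<close>
  define P where "P k = (\<Sum>i\<le>2^\<gamma>. prob (rank_event (2^\<alpha>) h z a k i))" for k
  have meas: "rank_event (2^\<alpha>) h z a k i \<in> sets M" for k i
    using h by (intro sets_rank_event) simp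
  have P_eq: "P k = prob (\<Union>i\<le>2^\<gamma>. rank_event (2^\<alpha>) h z a k i)" for k
    unfolding P_def using meas
    by (intro finite_measure_finite_Union[symmetric] disjoint_rank_event) auto
  have half: "P (Suc k) \<le> P k / 2" for k
  proof -
    define G where "G = real \<gamma> - real \<beta>"
    have G: "0 < G"
      using exps by (simp add: G_def)
    \<comment> \<open>The closed range ends at \<open>2^(\<gamma> + 1)\<close>, so the half-open
      dyadic range must go one exponent further; this explains the \<open>+ 2\<close>.\<close>
    have "{2^\<alpha>..2 * 2^\<gamma>} \<subseteq> {2^\<alpha>..<2^(\<gamma> + 2)::nat}"
    proof
      fix x :: nat
      assume "x \<in> {2^\<alpha>..2 * 2^\<gamma>}"
      moreover have "2 * 2^\<gamma> < (2::nat)^(\<gamma> + 2)"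
        by simp
      ultimately show "x \<in> {2^\<alpha>..<2^(\<gamma> + 2)}"
        unfolding atLeastAtMost_iff atLeastLessThan_iff by linarith
    qed
    then have "(\<Sum>d\<in>{2^\<alpha>..2 * 2^\<gamma>}. 1 / real d) \<le> (\<Sum>d\<in>{2^\<alpha>..<2^(\<gamma> + 2)}. 1 / real d)"
      by (intro sum_mono2) auto
    also have "\<dots> \<le> real (\<gamma> + 2) - real \<alpha>"
      using exps by (intro sum_inverse_dyadic) auto
    finally have U: "(\<Sum>d\<in>{2^\<alpha>..2 * 2^\<gamma>}. 1 / real d) \<le> real \<gamma> + 2 - real \<alpha>"
      by simp
    have "(real \<gamma> - real \<beta>) / 2 \<le> (\<Sum>d\<in>{2^\<beta>..<2^\<gamma>}. 1 / real d)"
      using exps by (intro sum_inverse_dyadic) auto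
    also have "\<dots> \<le> (\<Sum>d\<in>{2^\<beta>..2^\<gamma>}. 1 / real d)"
      by (intro sum_mono2) auto
    finally have L: "(real \<gamma> - real \<beta>) / 2 \<le> (\<Sum>d\<in>{2^\<beta>..2^\<gamma>}. 1 / real d)" .
    have P0: "0 \<le> P k" for k
      by (simp add: P_def sum_nonneg)
    have "(1/3::real) \<le> exp (-1)"
      using exp_le by (simp add: exp_minus field_simps)
    then have "(1/3) * ((real \<gamma> - real \<beta>) / 2) \<le> exp (-1) * (\<Sum>d\<in>{2^\<beta>..2^\<gamma>}. 1 / real d)"
      using L exps by (intro mult_mono) auto
    then have "P (Suc k) * ((1/3) * ((real \<gamma> - real \<beta>) / 2)) \<le> P (Suc k) * (exp (-1) * (\<Sum>d\<in>{2^\<beta>..2^\<gamma>}. 1 / real d))"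
      using P0 by (intro mult_left_mono)
    also have "\<dots> \<le> P k * (\<Sum>d\<in>{2^\<alpha>..2 * 2^\<gamma>}. 1 / real d)"
      unfolding P_def using sep by (intro return_step[OF h a]) auto
    also have "\<dots> \<le> P k * ((real \<gamma> - real \<beta>) / 12)"
      using P0 U exps by (intro mult_left_mono) auto
    finally have "P (Suc k) * ((1/3) * (G / 2)) \<le> P k * (G / 12)"
      unfolding G_def .
    then have "P (Suc k) * G \<le> (P k / 2) * G"
      by (simp add: mult.commute)
    then show ?thesis
      using G by (simp only: mult_le_cancel_right_pos)
  qed
  have "P k \<le> (1/2)^k"
  proof (induction k)
    case 0
    then show ?case by (simp add: P_eq)
  next
    case (Suc k)
    then show ?case using half[of k] by simp
  qed
  moreover have "prob {\<omega>\<in>space M. k < card {i. i \<le> 2^\<gamma> \<and> spaced (2^\<alpha>) (hits h z a \<omega>) i}} \<le> P k"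
    unfolding P_eq using meas by (intro finite_measure_mono) (auto dest!: spaced_rank_exists)
  ultimately show ?thesis
    by linarith
qed

end

section \<open>Modulus of continuity\<close>

text \<open>By continuity \<open>b t\<close> is the limit of \<open>b\<close> along the dyadic
  roundings of \<open>t\<close> from below. Consecutive roundings agree or differ by one step of the
  finer grid, so the increments are dominated by a geometric series.\<close>

lemma dyadic_chaining:
  fixes b :: "real \<Rightarrow> 'b :: real_normed_vector"
  assumes cont: "continuous_on {0..} b" and \<rho>: "0 \<le> \<rho>" "\<rho> < 1" and t: "0 \<le> t" "t < 2^N"
    and incr: "\<And>p j. P \<le> p \<Longrightarrow> j < 2^(N + p) \<Longrightarrow> norm (b (real (Suc j) * (1/2)^p) - b (real j * (1/2)^p)) \<le> \<rho>^p"
  shows "norm (b t - b (real (nat \<lfloor>t * 2^P\<rfloor>) * (1/2)^P)) \<le> \<rho>^P / (1 - \<rho>)"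
proof -
  define k where "k p = nat \<lfloor>t * 2^p\<rfloor>" for p
  define u where "u p = real (k p) * (1/2)^p" for p
  have k: "real (k p) \<le> t * 2^p" "t * 2^p < real (k p) + 1" for p
  proof -
    have "real (k p) = of_int \<lfloor>t * 2^p\<rfloor>"
      using t by (simp add: k_def)
    then show "real (k p) \<le> t * 2^p" "t * 2^p < real (k p) + 1"
      by linarith+
  qed
  have step: "norm (b (u (Suc p)) - b (u p)) \<le> \<rho>^Suc p" if p: "P \<le> p" for p
  proof -
    have "real (k (Suc p)) < real (2 * k p + 2)" "real (2 * k p) < real (k (Suc p) + 1)"
      using k[of p] k[of "Suc p"] by auto
    \<comment> \<open>Doubling a number doubles its floor, possibly adding one; only the second case
      moves the point.\<close>
    then consider "k (Suc p) = 2 * k p" | "k (Suc p) = Suc (2 * k p)"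
      unfolding of_nat_less_iff by linarith
    then show ?thesis
    proof cases
      case 1
      then show ?thesis
        using \<rho> by (simp add: u_def)
    next
      case 2
      have "real (2 * k p) < real (2^(N + Suc p))"
      proof -
        have "t * 2^Suc p < 2^N * 2^Suc p"
          using t by (intro mult_strict_right_mono) auto
        moreover have "real (2 * k p) \<le> t * 2^Suc p"
          using k[of p] by simp
        ultimately have "real (2 * k p) < 2^N * 2^Suc p"
          by linarith
        then show ?thesis
          by (simp add: power_add)
      qed
      then have "2 * k p < 2^(N + Suc p)"
        by (simp only: of_nat_less_iff)
      from incr[OF _ this] p have "norm (b (real (Suc (2 * k p)) * (1/2)^Suc p) - b (real (2 * k p) * (1/2)^Suc p)) \<le> \<rho>^Suc p"
        by simp
      moreover have "real (2 * k p) * (1/2)^Suc p = u p"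
        by (simp add: u_def)
      ultimately show ?thesis
        by (simp add: u_def[of "Suc p"] 2)
    qed
  qed
  have bound: "norm (b (u (P + l)) - b (u P)) \<le> \<rho>^P / (1 - \<rho>)" for l
  proof -
    have "b (u (P + l)) - b (u P) = (\<Sum>i<l. b (u (Suc (P + i))) - b (u (P + i)))"
      using sum_lessThan_telescope[of "\<lambda>i. b (u (P + i))" l] by simp
    also have "norm \<dots> \<le> (\<Sum>i<l. \<rho>^Suc (P + i))"
      by (intro sum_norm_le step) auto
    also have "\<dots> = \<rho>^Suc P * (\<Sum>i<l. \<rho>^i)"
      by (simp add: sum_distrib_left power_add mult.assoc)
    also have "(\<Sum>i<l. \<rho>^i) \<le> 1 / (1 - \<rho>)"
      using \<rho> sum_le_suminf[of "\<lambda>i. \<rho>^i" "{..<l}"] by (simp add: suminf_geometric summable_geometric)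
    also have "\<rho>^Suc P * (1 / (1 - \<rho>)) \<le> \<rho>^P * (1 / (1 - \<rho>))"
      using \<rho> by (intro mult_right_mono power_decreasing) auto
    finally show ?thesis
      using \<rho> by (simp add: mult_left_mono)
  qed
  have "(\<lambda>l. u (P + l)) \<longlonglongrightarrow> t"
  proof -
    have "(\<lambda>p. t - (1/2)^p) \<longlonglongrightarrow> t - 0"
      by (intro tendsto_intros LIMSEQ_realpow_zero) auto
    moreover have "t - (1/2)^p \<le> u p" "u p \<le> t" for p
    proof -
      have "t \<le> (real (k p) + 1) / 2^p" "real (k p) / 2^p \<le> t"
        using k[of p] by (auto simp: le_divide_eq divide_le_eq)
      then show "t - (1/2)^p \<le> u p" "u p \<le> t"
        by (simp_all add: u_def power_divide add_divide_distrib)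
    qed
    ultimately have "u \<longlonglongrightarrow> t"
      by (intro tendsto_sandwich[of "\<lambda>p. t - (1/2)^p" u _ "\<lambda>_. t"]) auto
    then show ?thesis
      unfolding add.commute[of P] by (rule LIMSEQ_ignore_initial_segment)
  qed
  moreover have "u p \<in> {0..}" for p
    by (simp add: u_def)
  ultimately have "(\<lambda>l. b (u (P + l))) \<longlonglongrightarrow> b t"
    using t cont by (intro continuous_on_tendsto_compose[OF cont]) auto
  then have "(\<lambda>l. norm (b (u (P + l)) - b (u P))) \<longlonglongrightarrow> norm (b t - b (u P))"
    by (intro tendsto_intros)
  then show ?thesis
    using bound by (intro tendsto_upperbound[where F = sequentially and f = "\<lambda>l. norm (b (u (P + l)) - b (u P))"])
      (auto simp: u_def k_def)
qed

context planar_brownian_motion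
begin

text \<open>An increment over \<open>(1/2)^p\<close> has standard deviation
  \<open>(1/2)^(p/2)\<close> per coordinate, geometrically smaller than \<open>(9/10)^p\<close>. The
  Gaussian tail then beats the \<open>2^(N + p)\<close> intervals, and Borel-Cantelli
  applies.\<close>

lemma AE_dyadic_increments:
  "AE \<omega> in M. \<forall>\<^sub>F p in sequentially. \<forall>j<2^(N + p).
     norm (B (real (Suc j) * (1/2)^p) \<omega> - B (real j * (1/2)^p) \<omega>) \<le> (9/10)^p"
proof -
  define A where "A p j = {\<omega>\<in>space M. (9/10)^p < norm (B (real (Suc j) * (1/2)^p) \<omega> - B (real j * (1/2)^p) \<omega>)}" for p j
  define bad where "bad p = (\<Union>j<2^(N + p). A p j)" for p
  have A: "A p j \<in> sets M" for p j
  proof -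
    have [measurable]: "B (real (Suc j) * (1/2)^p) \<in> borel_measurable M" "B (real j * (1/2)^p) \<in> borel_measurable M"
      by (auto intro!: random_variable_B)
    show ?thesis
      unfolding A_def by measurable
  qed
  have bad: "bad p \<in> sets M" for p
    using A by (auto simp: bad_def)
  have bound: "prob (bad p) \<le> 64 * 2^N * (5000/6561)^p" for p
  proof -
    have one: "prob (A p j) \<le> 64 * (2500/6561)^p" for j
    proof -
      \<comment> \<open>This is the exponent in the tail bound:
        \<open>(9/10)^2 * 2 = 81/50\<close>.\<close>
      define y where "y = (81/50)^p / (4::real)"
      have y: "0 < y" by (simp add: y_def)
      have "prob (A p j) \<le> 2 * exp (- ((9/10)^p)\<^sup>2 / (4 * (real (Suc j) * (1/2)^p - real j * (1/2)^p)))"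
        unfolding A_def by (intro increment_tail) auto
      also have "((9/10)^p)\<^sup>2 / (4 * (real (Suc j) * (1/2)^p - real j * (1/2)^p)) = y"
      proof -
        have "real (Suc j) * (1/2)^p - real j * (1/2)^p = (1/2::real)^p"
          by (simp add: algebra_simps)
        moreover have "((9/10)^p)\<^sup>2 = (81/50)^p * (1/2::real)^p"
          by (simp add: power_mult_distrib[symmetric] power2_eq_square)
        ultimately show ?thesis
          by (simp add: y_def)
      qed
      then have "2 * exp (- ((9/10)^p)\<^sup>2 / (4 * (real (Suc j) * (1/2)^p - real j * (1/2)^p))) = 2 * exp (- y)"
        by simp
      \<comment> \<open>A quadratic bound on the exponential suffices, because
        \<open>2 * (50/81)^2 = 5000/6561\<close> is below 1.\<close>
      also have "exp (- y) \<le> 2 / y\<^sup>2"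
      proof -
        have "y\<^sup>2 / 2 \<le> exp y"
          using exp_lower_Taylor_quadratic[of y] y by linarith
        then show ?thesis
          using y by (simp add: exp_minus field_simps)
      qed
      also have "2 * (2 / y\<^sup>2) = 64 * (2500/6561)^p"
        by (simp add: y_def power2_eq_square power_mult_distrib[symmetric] power_divide)
      finally show ?thesis
        by simp
    qed
    have "prob (bad p) \<le> (\<Sum>j<2^(N + p). prob (A p j))"
      unfolding bad_def using A by (intro finite_measure_subadditive_finite) auto
    also have "\<dots> \<le> of_nat (card {..<2^(N + p)::nat}) * (64 * (2500/6561)^p)"
      using one by (intro sum_bounded_above)
    also have "\<dots> = 64 * 2^N * (2^p * (2500/6561)^p)"
      by (simp add: power_add)
    also have "2^p * (2500/6561)^p = (5000/6561::real)^p"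
      by (simp add: power_mult_distrib[symmetric])
    finally show ?thesis .
  qed
  have "summable (\<lambda>p. 64 * 2^N * (5000/6561::real)^p)"
    by (intro summable_mult summable_geometric) auto
  then have "summable (\<lambda>p. prob (bad p))"
    by (rule summable_comparison_test'[where N = 0]) (simp add: bound)
  then have "AE \<omega> in M. \<forall>\<^sub>F p in sequentially. \<omega> \<in> space M - bad p"
    using bad by (intro borel_cantelli_AE1) (auto simp: emeasure_eq_measure)
  then show ?thesis
    by (rule AE_mp) (auto simp: bad_def A_def not_less elim!: eventually_mono)
qed

end

section \<open>Covering all level sets\<close>

lemma abs_le_imp_floor_mem:
  fixes x :: real
  assumes "\<bar>x\<bar> \<le> real_of_int N"
  shows "\<lfloor>x\<rfloor> \<in> {- N..N}"
proof -
  have "- N \<le> \<lfloor>x\<rfloor>"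
    using assms by (simp add: le_floor_iff abs_le_iff)
  moreover have "real_of_int \<lfloor>x\<rfloor> \<le> real_of_int N"
    using assms of_int_floor_le[of x] by linarith
  ultimately show ?thesis
    by simp
qed

definition grid_point :: "real \<Rightarrow> int \<times> int \<Rightarrow> real ^ 2" where
  "grid_point r g = vector [of_int (fst g) * r, of_int (snd g) * r]"

text \<open>Round each coordinate down to a multiple of \<open>r\<close>; the bound on
  \<open>x\<close> keeps the resulting indices in range.\<close>

lemma ex_near_grid_point:
  fixes x :: "real ^ 2"
  assumes "0 < r" "\<And>i. \<bar>x $ i\<bar> \<le> of_int N * r"
  shows "\<exists>g\<in>{-N..N} \<times> {-N..N}. \<forall>i. \<bar>x $ i - grid_point r g $ i\<bar> \<le> r"
proof -
  have *: "\<lfloor>x $ i / r\<rfloor> \<in> {-N..N}" "\<bar>x $ i - of_int \<lfloor>x $ i / r\<rfloor> * r\<bar> \<le> r" for i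
  proof -
    have "\<bar>x $ i / r\<bar> \<le> of_int N"
      using assms by (simp add: abs_divide divide_le_eq)
    then show "\<lfloor>x $ i / r\<rfloor> \<in> {-N..N}"
      by (rule abs_le_imp_floor_mem)
    have "x $ i - of_int \<lfloor>x $ i / r\<rfloor> * r = (x $ i / r - of_int \<lfloor>x $ i / r\<rfloor>) * r"
      using assms by (simp add: left_diff_distrib)
    moreover have "\<bar>x $ i / r - of_int \<lfloor>x $ i / r\<rfloor>\<bar> \<le> 1"
      by linarith
    ultimately show "\<bar>x $ i - of_int \<lfloor>x $ i / r\<rfloor> * r\<bar> \<le> r"
      using assms by (simp add: abs_mult)
  qed
  show ?thesis
    using *[of 1] *[of 2]
    by (intro bexI[of _ "(\<lfloor>x $ 1 / r\<rfloor>, \<lfloor>x $ 2 / r\<rfloor>)"]) (auto simp: grid_point_def forall_2)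
qed

context planar_brownian_motion
begin

text \<open>With time step \<open>(1/2)^(56*q)\<close>, a gap of \<open>2^(55*q)\<close> steps lasts
  \<open>(1/2)^q\<close>, and \<open>2^(N + 56*q)\<close> steps reach time \<open>2^N\<close>. The
  tail \<open>(1/2)^(21*q)\<close> beats the order of \<open>2^(14*q)\<close> grid squares, and the
  remaining \<open>(1/128)^q\<close> is summable.\<close>

lemma AE_few_spaced_hits:
  "AE \<omega> in M. \<forall>\<^sub>F q in sequentially. \<forall>g\<in>{-int (R * 2^(7*q))..int (R * 2^(7*q))} \<times> {-int (R * 2^(7*q))..int (R * 2^(7*q))}.
     card {i. i \<le> 2^(N + 56*q) \<and> spaced (2^(55*q)) (hits ((1/2)^(56*q)) (grid_point ((1/2)^(7*q)) g) (2 * (1/2)^(7*q)) \<omega>) i} \<le> 21 * q"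
proof -
  define I where "I q = {-int (R * 2^(7*q))..int (R * 2^(7*q))} \<times> {-int (R * 2^(7*q))..int (R * 2^(7*q))}" for q
  define A where "A q g = {\<omega>\<in>space M. 21 * q < card {i. i \<le> 2^(N + 56*q) \<and>
      spaced (2^(55*q)) (hits ((1/2)^(56*q)) (grid_point ((1/2)^(7*q)) g) (2 * (1/2)^(7*q)) \<omega>) i}}" for q g
  define bad where "bad q = (\<Union>g\<in>I q. A q g)" for q
  have fin: "finite (I q)" for q
    by (simp add: I_def)
  have A: "A q g \<in> sets M" for q g
    unfolding A_def
  proof (rule sets_Collect_finite_pattern[where j = "2^(N + 56*q)"
      and G = "\<lambda>H. 21 * q < card {i. i \<le> 2^(N + 56*q) \<and> spaced (2^(55*q)) H i}"])
    fix H H' :: "nat \<Rightarrow> bool"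
    assume "\<And>l. l \<le> 2^(N + 56*q) \<Longrightarrow> H l = H' l"
    then have "\<And>i. i \<le> 2^(N + 56*q) \<Longrightarrow> spaced (2^(55*q)) H i = spaced (2^(55*q)) H' i"
      by (intro spaced_cong) auto
    then have "{i. i \<le> 2^(N + 56*q) \<and> spaced (2^(55*q)) H i} = {i. i \<le> 2^(N + 56*q) \<and> spaced (2^(55*q)) H' i}"
      by blast
    then show "(21 * q < card {i. i \<le> 2^(N + 56*q) \<and> spaced (2^(55*q)) H i}) =
        (21 * q < card {i. i \<le> 2^(N + 56*q) \<and> spaced (2^(55*q)) H' i})"
      by simp
  qed simp
  have bad: "bad q \<in> sets M" for q
    using A fin by (auto simp: bad_def)
  \<comment> \<open>With \<open>\<alpha> = 55*q\<close>, \<open>\<beta> = 42*q + 4\<close> and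
    \<open>\<gamma> = N + 56*q\<close>, the condition on the exponents reads
    \<open>11*N + 28 \<le> 2*q\<close>, which this threshold ensures.\<close>
  have bound: "prob (bad q) \<le> (2 * real R + 1)\<^sup>2 * (1/128)^q" if q: "6 * N + 14 \<le> q" for q
  proof -
    have "prob (A q g) \<le> (1/2)^(21 * q)" for g
      unfolding A_def
    proof (rule many_spaced_hits_prob[where \<beta> = "42 * q + 4"])
      \<comment> \<open>Here \<open>\<beta>\<close> gives equality: both sides are
        \<open>16 * (1/2)^(14*q)\<close>.\<close>
      show "4 * (2 * (1/2)^(7*q))\<^sup>2 \<le> 2^(42 * q + 4) * (1/2::real)^(56*q)"
      proof -
        have "(2::real)^(42 * q) * (1/2)^(56*q) = (1/2)^(14*q)"
        proof -
          have "(1/2::real)^(56*q) = (1/2)^(42*q) * (1/2)^(14*q)"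
            by (simp add: power_add[symmetric])
          then show ?thesis
            by (simp add: power_mult_distrib[symmetric] mult.assoc[symmetric])
        qed
        moreover have "((1/2::real)^(7*q))\<^sup>2 = (1/2)^(14*q)"
          by (simp add: power_mult[symmetric] mult.commute)
        ultimately show ?thesis
          by (simp add: power_add power_mult_distrib mult.assoc)
      qed
    qed (use q in auto)
    then have "(\<Sum>g\<in>I q. prob (A q g)) \<le> of_nat (card (I q)) * (1/2)^(21 * q)"
      by (intro sum_bounded_above)
    moreover have "prob (bad q) \<le> (\<Sum>g\<in>I q. prob (A q g))"
      unfolding bad_def using A fin by (intro finite_measure_subadditive_finite) auto
    moreover have "of_nat (card (I q)) * (1/2)^(21 * q) \<le> (2 * real R + 1)\<^sup>2 * (1/128)^q"
    proof -
      have "card ({-int K..int K} \<times> {-int K..int K}) = (2 * K + 1)\<^sup>2" for K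
        by (simp add: card_cartesian_product power2_eq_square nat_add_distrib nat_mult_distrib)
      then have "card (I q) = (2 * (R * 2^(7*q)) + 1)\<^sup>2"
        unfolding I_def .
      then have "real (card (I q)) = (2 * real R * 2^(7*q) + 1)\<^sup>2"
        by simp
      also have "\<dots> \<le> ((2 * real R + 1) * 2^(7*q))\<^sup>2"
        by (intro power_mono) (auto simp: distrib_right)
      also have "\<dots> = (2 * real R + 1)\<^sup>2 * 2^(14*q)"
        by (simp add: power_mult_distrib power_mult[symmetric] mult.commute)
      finally have "of_nat (card (I q)) * (1/2)^(21 * q) \<le> (2 * real R + 1)\<^sup>2 * (2^(14*q) * (1/2)^(21 * q))"
        by (simp add: mult.assoc[symmetric] mult_right_mono)
      also have "(2::real)^(14*q) * (1/2)^(21 * q) = (1/128)^q"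
      proof -
        have "(1/2::real)^(21*q) = (1/2)^(14*q) * (1/2)^(7*q)"
          by (simp add: power_add[symmetric])
        moreover have "(1/2::real)^(7*q) = (1/128)^q"
          by (simp add: power_mult power_divide)
        ultimately show ?thesis
          by (simp add: power_mult_distrib[symmetric] mult.assoc[symmetric])
      qed
      finally show ?thesis .
    qed
    ultimately show ?thesis
      by linarith
  qed
  have "summable (\<lambda>q. (2 * real R + 1)\<^sup>2 * (1/128::real)^q)"
    by (intro summable_mult summable_geometric) auto
  then have "summable (\<lambda>q. prob (bad q))"
    by (rule summable_comparison_test'[where N = "6 * N + 14"]) (use bound in simp)
  then have "AE \<omega> in M. \<forall>\<^sub>F q in sequentially. \<omega> \<in> space M - bad q"
    using bad by (intro borel_cantelli_AE1) (auto simp: emeasure_eq_measure)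
  then have "AE \<omega> in M. \<forall>\<^sub>F q in sequentially. \<forall>g\<in>I q. \<not> 21 * q < card {i. i \<le> 2^(N + 56*q) \<and>
      spaced (2^(55*q)) (hits ((1/2)^(56*q)) (grid_point ((1/2)^(7*q)) g) (2 * (1/2)^(7*q)) \<omega>) i}"
    by (rule AE_mp) (intro AE_I2 impI, elim eventually_mono, auto simp: bad_def A_def)
  then show ?thesis
    unfolding I_def not_less .
qed

end

text \<open>Along \<open>(1/2)^q\<close> the logarithm of the inverse is \<open>q * ln 2\<close>.
  The limit is the cost of order \<open>q\<close> intervals of length
  \<open>(1/2)^q\<close>.\<close>

lemma gauge_dyadic_tendsto:
  fixes \<phi> :: "real \<Rightarrow> real"
  assumes "((\<lambda>\<epsilon>. \<phi> \<epsilon> * ln (1 / \<epsilon>)) \<longlongrightarrow> 0) (at_right 0)"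
  shows "(\<lambda>q. real q * \<phi> ((1/2)^q)) \<longlonglongrightarrow> 0"
proof -
  have "filterlim (\<lambda>q. (1/2::real)^q) (at_right 0) sequentially"
    by (intro tendsto_imp_filterlim_at_right LIMSEQ_realpow_zero always_eventually) auto
  from filterlim_compose[OF assms this]
  have "(\<lambda>q. \<phi> ((1/2)^q) * ln (1 / (1/2)^q) / ln 2) \<longlonglongrightarrow> 0 / ln 2"
    by (intro tendsto_divide) auto
  moreover have "\<phi> ((1/2)^q) * ln (1 / (1/2)^q) / ln 2 = real q * \<phi> ((1/2)^q)" for q
    by (simp add: power_divide ln_realpow)
  ultimately show ?thesis
    by simp
qed

section \<open>Covers of a single level set and its Hausdorff content\<close>

context planar_brownian_motion
begin

text \<open>Round \<open>t\<close> down to the time grid. Chaining moves the path by at most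
  \<open>r\<close>, and \<open>x\<close> is within \<open>r\<close> of \<open>z\<close>, so the
  rounded time hits the square of half-side \<open>2 * r\<close>; a selected hit then lies fewer
  than \<open>2^(55*q)\<close> steps earlier.\<close>

lemma level_set_cover:
  assumes cont: "continuous_on {0..} (\<lambda>t. B t \<omega>)"
    and incr: "\<And>p j. 56 * q \<le> p \<Longrightarrow> j < 2^(N + p) \<Longrightarrow>
      norm (B (real (Suc j) * (1/2)^p) \<omega> - B (real j * (1/2)^p) \<omega>) \<le> (9/10)^p"
    and q: "10 * (9/10)^(56*q) \<le> (1/2::real)^(7*q)"
    and near: "\<And>i. \<bar>x $ i - z $ i\<bar> \<le> (1/2)^(7*q)"
  shows "{t. 0 \<le> t \<and> t < 2^N \<and> B t \<omega> - B 0 \<omega> = x} \<subseteq>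
    (\<Union>j\<in>{i. i \<le> 2^(N + 56*q) \<and> spaced (2^(55*q)) (hits ((1/2)^(56*q)) z (2 * (1/2)^(7*q)) \<omega>) i}.
      {real j * (1/2)^(56*q) .. real j * (1/2)^(56*q) + (1/2)^q})"
proof
  define h r where "h = (1/2::real)^(56*q)" and "r = (1/2::real)^(7*q)"
  have h: "0 < h" "2^(56*q) * h = 1"
    by (simp_all add: h_def power_mult_distrib[symmetric])
  fix t assume "t \<in> {t. 0 \<le> t \<and> t < 2^N \<and> B t \<omega> - B 0 \<omega> = x}"
  then have t: "0 \<le> t" "t < 2^N" "B t \<omega> - B 0 \<omega> = x"
    by auto
  define i where "i = nat \<lfloor>t * 2^(56*q)\<rfloor>"
  have i: "real i \<le> t * 2^(56*q)" "t * 2^(56*q) < real i + 1"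
  proof -
    have "real i = of_int \<lfloor>t * 2^(56*q)\<rfloor>"
      using t by (simp add: i_def)
    then show "real i \<le> t * 2^(56*q)" "t * 2^(56*q) < real i + 1"
      by linarith+
  qed
  have th: "t * 2^(56*q) * h = t"
    using h(2) by simp
  have it: "real i * h \<le> t" "t < (real i + 1) * h"
    using mult_right_mono[OF i(1), of h] mult_strict_right_mono[OF i(2), of h] h(1) unfolding th by auto
  \<comment> \<open>The geometric series contributes \<open>1 / (1 - 9/10) = 10\<close>, the factor
    in assumption \<open>q\<close>.\<close>
  have "norm (B t \<omega> - B (real i * (1/2)^(56*q)) \<omega>) \<le> (9/10)^(56*q) / (1 - 9/10)"
    unfolding i_def by (rule dyadic_chaining[OF cont _ _ t(1,2) incr]) auto
  then have close: "norm (B t \<omega> - B (real i * h) \<omega>) \<le> r"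
    using q by (simp add: h_def r_def)
  have "hits h z (2 * r) \<omega> i"
    unfolding hits_def square_def
  proof (intro CollectI allI)
    fix c
    have "\<bar>(B t \<omega> - B (real i * h) \<omega>) $ c\<bar> \<le> r"
      using component_le_norm_cart[of "B t \<omega> - B (real i * h) \<omega>" c] close by linarith
    moreover have "\<bar>(B t \<omega> - B 0 \<omega>) $ c - z $ c\<bar> \<le> r"
      using near[of c] t(3) by (simp add: r_def)
    ultimately show "\<bar>(B (real i * h) \<omega> - B 0 \<omega>) $ c - z $ c\<bar> \<le> 2 * r"
      unfolding vector_minus_component by linarith
  qed
  from ex_spaced_before_hit[of "hits h z (2 * r) \<omega>", OF this, of "2^(55*q)"]
  obtain j where j: "j \<le> i" "spaced (2^(55*q)) (hits h z (2 * r) \<omega>) j" "i < j + 2^(55*q)"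
    by auto
  have "real i < 2^(N + 56*q)"
  proof -
    have "t * 2^(56*q) < 2^N * 2^(56*q)"
      using t by (intro mult_strict_right_mono) auto
    then show ?thesis
      using i(1) unfolding power_add by linarith
  qed
  then have "real i < real (2^(N + 56*q))"
    by simp
  then have "i < 2^(N + 56*q)"
    by (simp only: of_nat_less_iff)
  moreover have "real j * h \<le> t"
  proof -
    have "real j * h \<le> real i * h"
      using j(1) h(1) by (intro mult_right_mono) auto
    then show ?thesis
      using it by linarith
  qed
  moreover have "t \<le> real j * h + (1/2)^q"
  proof -
    \<comment> \<open>The strict inequality for \<open>i\<close> leaves the one extra step needed
      because \<open>t\<close> may lie anywhere before \<open>(i + 1) * h\<close>.\<close>
    have "real (i + 1) \<le> real (j + 2^(55*q))"
      using j(3) by (simp only: of_nat_le_iff)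
    then have "(real i + 1) * h \<le> (real j + 2^(55*q)) * h"
      using h(1) by (intro mult_right_mono) auto
    moreover have "2^(55*q) * h = (1/2)^q"
    proof -
      have "h = (1/2)^(55*q) * (1/2)^q"
        by (simp add: h_def power_add[symmetric])
      then show ?thesis
        by (simp add: power_mult_distrib[symmetric] mult.assoc[symmetric])
    qed
    ultimately show ?thesis
      using it(2) by (simp add: distrib_right)
  qed
  ultimately show "t \<in> (\<Union>j\<in>{i. i \<le> 2^(N + 56*q) \<and> spaced (2^(55*q)) (hits ((1/2)^(56*q)) z (2 * (1/2)^(7*q)) \<omega>) i}.
      {real j * (1/2)^(56*q) .. real j * (1/2)^(56*q) + (1/2)^q})"
    using j(1,2) unfolding h_def r_def by (intro UN_I[of j]) auto
qed

text \<open>At most \<open>21 * q\<close> intervals of length \<open>(1/2)^q\<close> cover the level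
  set, at a cost of at most \<open>21 * q * \<phi> ((1/2)^q)\<close>, which tends to 0. The three
  almost sure facts do not mention \<open>x\<close>, so one null set serves all levels.\<close>

lemma AE_bounded_level_set_content:
  fixes \<phi> :: "real \<Rightarrow> real"
  assumes \<phi>: "(\<phi> \<longlongrightarrow> 0) (at_right 0)"
    and log: "((\<lambda>\<epsilon>. \<phi> \<epsilon> * ln (1 / \<epsilon>)) \<longlongrightarrow> 0) (at_right 0)"
  shows "AE \<omega> in M. \<forall>x. (\<forall>i. \<bar>x $ i\<bar> \<le> real R) \<longrightarrow>
    (\<forall>\<delta>>0. hausdorff_content \<phi> \<delta> {t. 0 \<le> t \<and> t < 2^N \<and> B t \<omega> - B 0 \<omega> = x} = 0)"
  using continuous_paths AE_dyadic_increments[of N] AE_few_spaced_hits[of R N]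
proof eventually_elim
  fix \<omega>
  assume cont: "continuous_on {0..} (\<lambda>t. B t \<omega>)"
    and incr: "\<forall>\<^sub>F p in sequentially. \<forall>j<2^(N + p).
     norm (B (real (Suc j) * (1/2)^p) \<omega> - B (real j * (1/2)^p) \<omega>) \<le> (9/10)^p"
    and few: "\<forall>\<^sub>F q in sequentially. \<forall>g\<in>{-int (R * 2^(7*q))..int (R * 2^(7*q))} \<times> {-int (R * 2^(7*q))..int (R * 2^(7*q))}.
     card {i. i \<le> 2^(N + 56*q) \<and> spaced (2^(55*q)) (hits ((1/2)^(56*q)) (grid_point ((1/2)^(7*q)) g) (2 * (1/2)^(7*q)) \<omega>) i} \<le> 21 * q"
  show "\<forall>x. (\<forall>i. \<bar>x $ i\<bar> \<le> real R) \<longrightarrow>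
    (\<forall>\<delta>>0. hausdorff_content \<phi> \<delta> {t. 0 \<le> t \<and> t < 2^N \<and> B t \<omega> - B 0 \<omega> = x} = 0)"
  proof (intro allI impI)
    fix x :: "real^2" and \<delta> :: real
    assume x: "\<forall>i. \<bar>x $ i\<bar> \<le> real R" and \<delta>: "0 < \<delta>"
    define Z where "Z = {t. 0 \<le> t \<and> t < 2^N \<and> B t \<omega> - B 0 \<omega> = x}"
    have "hausdorff_content \<phi> \<delta> Z \<le> 0 + ennreal e" if e: "0 < e" for e :: real
    proof -
      obtain p0 where p0: "\<And>p j. p0 \<le> p \<Longrightarrow> j < 2^(N + p) \<Longrightarrow>
          norm (B (real (Suc j) * (1/2)^p) \<omega> - B (real j * (1/2)^p) \<omega>) \<le> (9/10)^p"
        using incr unfolding eventually_sequentially by blast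
      have "\<forall>\<^sub>F q in sequentially. (1/2)^q < \<delta>"
        using order_tendstoD(2)[OF LIMSEQ_realpow_zero[of "1/2::real"]] \<delta> by simp
      moreover have "\<forall>\<^sub>F q in sequentially. real q * \<phi> ((1/2)^q) < e / 21"
        using e by (intro order_tendstoD(2)[OF gauge_dyadic_tendsto[OF log]]) simp
      moreover have "\<forall>\<^sub>F q in sequentially. 10 * (9/10)^(56*q) \<le> (1/2::real)^(7*q)"
      proof -
        \<comment> \<open>Since \<open>(9/10)^8 < 1/2\<close>, the time exponent
          \<open>56 = 8 * 7\<close> makes the path oscillation geometrically smaller than the
          spatial resolution.\<close>
        have "(\<lambda>q. ((9/10)^56 * 2^7 :: real)^q) \<longlonglongrightarrow> 0"
          by (intro LIMSEQ_realpow_zero) (simp_all add: power_divide)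
        then have "\<forall>\<^sub>F q in sequentially. ((9/10)^56 * 2^7 :: real)^q < 1/10"
          by (rule order_tendstoD) simp
        then show ?thesis
        proof eventually_elim
          case (elim q)
          have "(9/10)^(56*q) = ((9/10)^56 * 2^7 :: real)^q * (1/2)^(7*q)"
            by (simp only: power_mult power_mult_distrib[symmetric] power_one_over) simp
          moreover have "((9/10)^56 * 2^7 :: real)^q * (1/2)^(7*q) \<le> 1/10 * (1/2)^(7*q)"
            using elim by (intro mult_right_mono) auto
          ultimately show ?case
            by linarith
        qed
      qed
      moreover have "\<forall>\<^sub>F q in sequentially. p0 \<le> 56 * q"
        using eventually_ge_at_top[of p0] by eventually_elim auto
      ultimately have "\<forall>\<^sub>F q in sequentially. hausdorff_content \<phi> \<delta> Z \<le> ennreal e"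
        using few
      proof eventually_elim
        case (elim q)
        define J where "J g = {i. i \<le> 2^(N + 56*q) \<and> spaced (2^(55*q)) (hits ((1/2)^(56*q)) (grid_point ((1/2)^(7*q)) g) (2 * (1/2)^(7*q)) \<omega>) i}" for g
        have "\<bar>x $ i\<bar> \<le> of_int (int (R * 2^(7*q))) * (1/2)^(7*q)" for i
          using x by (simp add: mult.assoc power_mult_distrib[symmetric])
        \<comment> \<open>The grid point may depend on \<open>x\<close>, because the bound on
          selected hits holds for all grid points at once.\<close>
        then obtain g where g: "g \<in> {-int (R * 2^(7*q))..int (R * 2^(7*q))} \<times> {-int (R * 2^(7*q))..int (R * 2^(7*q))}"
          "\<And>i. \<bar>x $ i - grid_point ((1/2)^(7*q)) g $ i\<bar> \<le> (1/2)^(7*q)"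
          using ex_near_grid_point[of "(1/2)^(7*q)" x "int (R * 2^(7*q))"] by auto
        have "Z \<subseteq> (\<Union>j\<in>J g. {real j * (1/2)^(56*q) .. real j * (1/2)^(56*q) + (1/2)^q})"
          unfolding Z_def J_def using elim p0 g(2) by (intro level_set_cover[OF cont]) auto
        then have "hausdorff_content \<phi> \<delta> Z \<le> of_nat (card (J g)) * ennreal (\<phi> ((1/2)^q))"
          using elim by (intro hausdorff_content_finite_cover[OF \<phi>]) (auto simp: J_def)
        also have "\<dots> \<le> of_nat (21 * q) * ennreal (\<phi> ((1/2)^q))"
          using elim g(1) unfolding J_def by (intro mult_right_mono of_nat_mono) auto
        also have "\<dots> = ennreal (21 * (real q * \<phi> ((1/2)^q)))"
          by (simp only: ennreal_of_nat_eq_real_of_nat ennreal_mult'[symmetric] of_nat_0_le_iff) (simp add: mult.assoc)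
        also have "\<dots> \<le> ennreal e"
          using elim by (intro ennreal_leI) simp
        finally show ?case .
      qed
      then show ?thesis
        using eventually_happens'[OF sequentially_bot] by simp
    qed
    then have "hausdorff_content \<phi> \<delta> Z \<le> 0"
      by (rule ennreal_le_epsilon)
    then show "hausdorff_content \<phi> \<delta> {t. 0 \<le> t \<and> t < 2^N \<and> B t \<omega> - B 0 \<omega> = x} = 0"
      by (simp add: Z_def)
  qed
qed

end

theorem theorem1p2:
  fixes M :: "'a measure" and B :: "real \<Rightarrow> 'a \<Rightarrow> real ^ 2" and \<phi> :: "real \<Rightarrow> real"
  assumes "standard_brownian_motion M B"
    and "gauge_function \<phi>"
    and "((\<lambda>\<epsilon>. \<phi> \<epsilon> * ln (1 / \<epsilon>)) \<longlongrightarrow> 0) (at_right 0)"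
  shows "AE \<omega> in M. \<forall>x. hausdorff_measure \<phi> {t. 0 \<le> t \<and> B t \<omega> = x} = 0"
proof -
  interpret planar_brownian_motion M B
    using assms(1) by (simp add: planar_brownian_motion_def)
  have \<phi>: "(\<phi> \<longlongrightarrow> 0) (at_right 0)"
    using assms(2) by (simp add: gauge_function_def)
  \<comment> \<open>Only the countably many pairs \<open>R\<close>, \<open>N\<close> are combined
    almost surely; the quantifier over \<open>x\<close> is already inside each event.\<close>
  have "AE \<omega> in M. \<forall>R N. \<forall>x. (\<forall>i. \<bar>x $ i\<bar> \<le> real R) \<longrightarrow>
    (\<forall>\<delta>>0. hausdorff_content \<phi> \<delta> {t. 0 \<le> t \<and> t < 2^N \<and> B t \<omega> - B 0 \<omega> = x} = 0)"
    unfolding AE_all_countable using AE_bounded_level_set_content[OF \<phi> assms(3)] by blast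
  then show ?thesis
    using start_zero
  proof eventually_elim
    fix \<omega>
    assume null: "\<forall>R N. \<forall>x. (\<forall>i. \<bar>x $ i\<bar> \<le> real R) \<longrightarrow>
      (\<forall>\<delta>>0. hausdorff_content \<phi> \<delta> {t. 0 \<le> t \<and> t < 2^N \<and> B t \<omega> - B 0 \<omega> = x} = 0)"
      and zero: "B 0 \<omega> = 0"
    show "\<forall>x. hausdorff_measure \<phi> {t. 0 \<le> t \<and> B t \<omega> = x} = 0"
    proof
      fix x :: "real ^ 2"
      have "\<bar>x $ i\<bar> \<le> real (nat \<lceil>norm x\<rceil>)" for i
        using component_le_norm_cart[of x i] real_nat_ceiling_ge[of "norm x"] by linarith
      then have *: "hausdorff_content \<phi> \<delta> {t. 0 \<le> t \<and> t < 2^N \<and> B t \<omega> = x} = 0" if "0 < \<delta>" for \<delta> N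
        using null that unfolding zero diff_zero by blast
      \<comment> \<open>Countable subadditivity removes the time horizon. Content zero at every
        scale then gives measure zero, as the measure is the supremum of the contents.\<close>
      have "{t. 0 \<le> t \<and> B t \<omega> = x} = (\<Union>N. {t. 0 \<le> t \<and> t < 2^N \<and> B t \<omega> = x})"
        using real_arch_pow[of 2] by auto
      then have "hausdorff_content \<phi> \<delta> {t. 0 \<le> t \<and> B t \<omega> = x} = 0" if "0 < \<delta>" for \<delta>
        using hausdorff_content_countable_subadditive[of \<phi> \<delta> "\<lambda>N. {t. 0 \<le> t \<and> t < 2^N \<and> B t \<omega> = x}"]
        by (simp add: *[OF that])
      then show "hausdorff_measure \<phi> {t. 0 \<le> t \<and> B t \<omega> = x} = 0"
        by (simp add: hausdorff_measure_eq_SUP)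
    qed
  qed
qed

end
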